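(* Let $m\in\mathbb{N}$ with $m\ge 70$, and let $g\ge 5$ be the largest integer satisfying $$2m\ \ge\ \left\lceil\frac{2^{g}-4}{g-4}\right\rceil\cdot g .$$ Then there exists a 3-regular graph $\Gamma_{2m}$ of girth $g$ with $2m$ vertices such that any connected cut-set of $\Gamma_{2m}$ contains at least $\lfloor g/2\rfloor$ vertices.
   Context: Graphs are finite and undirected. The girth of a graph is the length of a shortest cycle. For a graph $\Gamma$ with vertex set $V$ and $A\subset V$, $\Gamma[A]$ denotes the subgraph induced on $A$. A cut-set of $\Gamma$ is a subset $C\subset V$ such that $\Gamma[V\setminus C]$ is disconnected; it is a connected cut-set if moreover $\Gamma[C]$ is connected. *)

theory Defs
  imports
    Complex_Main
    "HOL-Library.Extended_Nat"
    "Graph_Theory.Digraph_Component"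
begin

text \<open>
  A finite undirected simple graph is a \<^locale>\<open>pair_graph\<close>: a finite vertex set with an
  irreflexive symmetric arc relation, each undirected edge being the two arcs (u,v) and (v,u).
  Allowing loops or parallel edges would add nothing below, since these are cycles of length
  1 and 2, and only girth at least 5 is considered.
\<close>

text \<open>
  \<^const>\<open>pre_digraph.cycle\<close> also accepts the closed walk u,v,u that traverses one undirected edge
  in both directions; the length bound rules this out, and leaves exactly the cycles of a simple
  undirected graph.
\<close>
definition undirected_cycle :: "'a pair_pre_digraph \<Rightarrow> ('a \<times> 'a) awalk \<Rightarrow> bool" where
  "undirected_cycle G p \<longleftrightarrow> pre_digraph.cycle (with_proj G) p \<and> 3 \<le> length p"

text \<open>The girth of a forest is \<open>\<infinity>\<close>.\<close>
definition girth :: "'a pair_pre_digraph \<Rightarrow> enat" where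
  "girth G = (INF p\<in>{p. undirected_cycle G p}. enat (length p))"

definition regular :: "nat \<Rightarrow> 'a pair_pre_digraph \<Rightarrow> bool" where
  "regular k G \<longleftrightarrow> (\<forall>v\<in>pverts G. out_degree (with_proj G) v = k)"

text \<open>
  \<^const>\<open>connected\<close> is false for the graph without vertices. Hence the full vertex set counts as a
  cut-set, and the empty set is never a connected cut-set.
\<close>
definition cut_set :: "'a pair_pre_digraph \<Rightarrow> 'a set \<Rightarrow> bool" where
  "cut_set G C \<longleftrightarrow>
     C \<subseteq> pverts G \<and> \<not> connected (with_proj G \<restriction> (pverts G - C))"

definition connected_cut_set :: "'a pair_pre_digraph \<Rightarrow> 'a set \<Rightarrow> bool" where
  "connected_cut_set G C \<longleftrightarrow> cut_set G C \<and> connected (with_proj G \<restriction> C)"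

end

theory Submission
  imports Defs
begin

text \<open>
  Put $n = 2m$, $h = \lfloor g/2 \rfloor$ and $L = \lceil g/2 \rceil$. Divide a Hamiltonian cycle on $n$
  vertices into blocks of length $L$ and join block $b$ to block $b + q$ by a chord, where
  $q > (h+1)/2$; add one more chord that closes a cycle of length $g$. This skeleton has girth $g$,
  and the hypothesis on $m$ leaves at least $2^g - 4$ of its vertices with degree 2, which is just
  enough for the edge switching of Erdos and Sachs to complete it, without touching its own
  edges, to a cubic graph of girth $g$.

  Suppose that a connected set $C$ with $|C| < h$ separates this graph. At most $|C| + 2$ edges leave
  $C$, so one of the two sides is left by $a \le (h+1)/2$ edges. The chords link the blocks into $q$ disjoint
  columns. As $a < q$, some column is not cut at all and lies on one side $Y$ of the edge cut; the
  other side $X$ lives in the few gaps between consecutive entries of that column, so its size is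
  polynomial in $g$. On the other hand $X$ has only $a$ leaving edges and girth at least $g$, so
  the Moore tree argument makes $|X|$ exponential in $g$.
\<close>

section \<open>Short walks and girth\<close>

text \<open>The edges supplied by the switching are beyond control, so every statement about small
  edge cuts is derived from the skeleton and holds for each cubic graph that contains its cycle and
  its chords; the completion contributes only degrees and girth.

  Consecutive parallel chords close a cycle of length 2L + 2, so blocks have to be about g/2 long.
  With that length the chords, the extra one included, occupy at most 4n/g vertices and leave at
  least n(g - 4)/g free: this is the factor g/(g - 4) of the hypothesis. The number 2^g - 4 comes
  from the switching: two balls of radius g - 2 around vertices of degree 2 have at most 2^g - 2
  vertices, counted with overlap, and three vertices of the overlap cannot obstruct a switch. For g
  = 5 the hypothesis reads 2m \<ge> 28 * 5 = 140, whence m \<ge> 70.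

  Besides exceeding the number a of cut edges, q is at least 4, which makes each chord span qL - 1
  \<ge> 2(g - 1) steps of the cycle. Distances in the skeleton are then read off from integer
  potentials that change by at most 1 along each arc.\<close>

definition near :: "'a rel \<Rightarrow> nat \<Rightarrow> 'a \<Rightarrow> 'a \<Rightarrow> bool" where
  "near E k x y \<longleftrightarrow> (x, y) \<in> (E \<union> Id) ^^ k"

definition add_edge :: "'a \<Rightarrow> 'a \<Rightarrow> 'a rel \<Rightarrow> 'a rel" where
  "add_edge x y E = E \<union> {(x, y), (y, x)}"

definition del_edge :: "'a \<Rightarrow> 'a \<Rightarrow> 'a rel \<Rightarrow> 'a rel" where
  "del_edge x y E = E - {(x, y), (y, x)}"

text \<open>
  A cycle through the edge $uv$ is a walk from $u$ to $v$ that avoids this edge, followed by the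
  edge. Walks rather than cycles make the property easy to maintain while edges are added.
\<close>
definition girth_ge :: "nat \<Rightarrow> 'a rel \<Rightarrow> bool" where
  "girth_ge g E \<longleftrightarrow> (\<forall>(u, v)\<in>E. \<not> near (del_edge u v E) (g - 2) u v)"

lemma near_0 [simp]: "near E 0 x y \<longleftrightarrow> x = y"
  by (simp add: near_def)

lemma near_refl [simp]: "near E k x x"
  unfolding near_def by (induction k) auto

lemma near_Suc: "near E (Suc k) x y \<longleftrightarrow> (\<exists>z. near E k x z \<and> (z = y \<or> (z, y) \<in> E))"
  unfolding near_def by auto

lemma near_Suc2: "near E (Suc k) x y \<longleftrightarrow> (\<exists>z. (x = z \<or> (x, z) \<in> E) \<and> near E k z y)"
proof -
  have "near E (Suc k) x y \<longleftrightarrow> (x, y) \<in> (E \<union> Id) O (E \<union> Id) ^^ k"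
    unfolding near_def by (simp only: relpow.simps relpow_commute)
  then show ?thesis by (auto simp: near_def relcomp_unfold)
qed

lemma near_step: "near E k x z \<Longrightarrow> (z, y) \<in> E \<Longrightarrow> near E (Suc k) x y"
  by (auto simp: near_Suc)

lemma near_step2: "(x, z) \<in> E \<Longrightarrow> near E k z y \<Longrightarrow> near E (Suc k) x y"
  by (auto simp: near_Suc2)

lemma near_add: "near E (j + k) x y \<longleftrightarrow> (\<exists>z. near E j x z \<and> near E k z y)"
  unfolding near_def by (auto simp: relpow_add)

lemma near_trans: "near E j x z \<Longrightarrow> near E k z y \<Longrightarrow> near E (j + k) x y"
  by (auto simp: near_add)

lemma near_mono: "near E j x y \<Longrightarrow> j \<le> k \<Longrightarrow> near E k x y"
  by (metis le_Suc_ex near_add near_refl)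

lemma near_subset: "near E k x y \<Longrightarrow> E \<subseteq> E' \<Longrightarrow> near E' k x y"
  by (induction k arbitrary: y) (auto simp: near_Suc)

lemma near_arc: "(x, y) \<in> E \<Longrightarrow> near E (Suc 0) x y"
  by (auto simp: near_Suc)

lemma near_arc_mono: "(x, y) \<in> E \<Longrightarrow> k \<ge> 1 \<Longrightarrow> near E k x y"
  using near_mono[OF near_arc[of x y E], of k] by simp

lemma near_sym: "sym E \<Longrightarrow> near E k x y \<longleftrightarrow> near E k y x"
proof -
  have "near E k y x" if "near E k x y" "sym E" for x y
    using that
  proof (induction k arbitrary: y)
    case (Suc k)
    then obtain z where "near E k x z" "z = y \<or> (z, y) \<in> E" by (auto simp: near_Suc)
    then have "near E k z x" "y = z \<or> (y, z) \<in> E" using Suc by (auto dest: symD)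
    then show ?case unfolding near_Suc2 by blast
  qed auto
  then show "sym E \<Longrightarrow> near E k x y \<longleftrightarrow> near E k y x" by blast
qed

lemma near_lipschitz:
  fixes f :: "'a \<Rightarrow> int"
  assumes "\<And>u v. (u, v) \<in> E \<Longrightarrow> f v \<le> f u + 1" "near E k x y"
  shows "f y \<le> f x + int k"
  using assms(2)
proof (induction k arbitrary: y)
  case (Suc k)
  then obtain z where "near E k x z" "z = y \<or> (z, y) \<in> E" by (auto simp: near_Suc)
  then show ?case using Suc.IH[of z] assms(1)[of z y] by auto
qed auto

lemma sym_add_edge: "sym E \<Longrightarrow> sym (add_edge x y E)"
  by (auto simp: sym_def add_edge_def)

lemma sym_del_edge: "sym E \<Longrightarrow> sym (del_edge x y E)"
  by (auto simp: sym_def del_edge_def)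

lemma del_edge_commute: "del_edge x y E = del_edge y x E"
  by (auto simp: del_edge_def)

text \<open>A walk that crosses the new edge more than once revisits one of its ends, and the detour
  in between can be cut out. So it suffices to record one crossing and its direction.\<close>

lemma near_add_edge:
  assumes "near (add_edge x y E) k u v"
  shows "near E k u v \<or> (\<exists>i j. i + j + 1 \<le> k \<and> near E i u x \<and> near E j y v) \<or>
    (\<exists>i j. i + j + 1 \<le> k \<and> near E i u y \<and> near E j x v)"
  using assms
proof (induction k arbitrary: v)
  case (Suc k)
  then obtain z where z: "near (add_edge x y E) k u z" "z = v \<or> (z, v) \<in> add_edge x y E"
    by (auto simp: near_Suc)
  consider "z = v \<or> (z, v) \<in> E" | "z = x" "v = y" | "z = y" "v = x"
    using z(2) by (auto simp: add_edge_def)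
  then show ?case
  proof cases
    case 1
    then have *: "near E (Suc j) w v" if "near E j w z" for j w
      using that by (auto simp: near_Suc)
    from Suc.IH[OF z(1)] show ?thesis
    proof (elim disjE exE conjE)
      fix i j assume "i + j + 1 \<le> k" "near E i u x" "near E j y z"
      then show ?thesis using *[of j y] by (intro disjI2 disjI1 exI[of _ i] exI[of _ "Suc j"]) auto
    next
      fix i j assume "i + j + 1 \<le> k" "near E i u y" "near E j x z"
      then show ?thesis using *[of j x] by (intro disjI2 exI[of _ i] exI[of _ "Suc j"]) auto
    qed (use * in auto)
  next
    case 2
    from Suc.IH[OF z(1)] show ?thesis
    proof (elim disjE exE conjE)
      fix i j assume "i + j + 1 \<le> k" "near E i u x" "near E j y z"
      then show ?thesis using 2 by (intro disjI2 disjI1 exI[of _ i] exI[of _ 0]) auto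
    next
      fix i j assume "i + j + 1 \<le> k" "near E i u y" "near E j x z"
      then show ?thesis using 2 near_mono[of E i u y "Suc k"] by auto
    next
      assume "near E k u z"
      then show ?thesis using 2 by (intro disjI2 disjI1 exI[of _ k] exI[of _ 0]) auto
    qed
  next
    case 3
    from Suc.IH[OF z(1)] show ?thesis
    proof (elim disjE exE conjE)
      fix i j assume "i + j + 1 \<le> k" "near E i u y" "near E j x z"
      then show ?thesis using 3 by (intro disjI2 exI[of _ i] exI[of _ 0]) auto
    next
      fix i j assume "i + j + 1 \<le> k" "near E i u x" "near E j y z"
      then show ?thesis using 3 near_mono[of E i u x "Suc k"] by auto
    next
      assume "near E k u z"
      then show ?thesis using 3 by (intro disjI2 exI[of _ k] exI[of _ 0]) auto
    qed
  qed
qed auto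

lemma girth_ge_subset: "girth_ge g E \<Longrightarrow> E' \<subseteq> E \<Longrightarrow> girth_ge g E'"
  unfolding girth_ge_def del_edge_def
  using near_subset[of "E' - S" k u v "E - S" for S k u v] by blast

lemma girth_geD: "girth_ge g E \<Longrightarrow> (u, v) \<in> E \<Longrightarrow> near (del_edge u v E) k u v \<Longrightarrow> g < k + 2"
  unfolding girth_ge_def using near_mono[of "del_edge u v E" k u v "g - 2"] by (cases "k \<le> g - 2") auto

text \<open>A short cycle through an old edge uv that is new must use xy. Its remaining pieces,
  joined by the edge uv instead, form a walk from x to y that is no longer than allowed by the
  distance hypothesis.\<close>

lemma girth_ge_add_edge:
  assumes "girth_ge g E" "sym E" "\<not> near E (g - 2) x y"
  shows "girth_ge g (add_edge x y E)"
  unfolding girth_ge_def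
proof (safe)
  fix u v assume uv: "(u, v) \<in> add_edge x y E"
    and nr: "near (del_edge u v (add_edge x y E)) (g - 2) u v"
  show False
  proof (cases "{u, v} = {x, y}")
    case True
    then have "del_edge u v (add_edge x y E) \<subseteq> E"
      by (auto simp: add_edge_def del_edge_def doubleton_eq_iff)
    with nr have "near E (g - 2) u v" by (rule near_subset)
    with True assms show False by (auto simp: doubleton_eq_iff near_sym)
  next
    case False
    with uv have "(u, v) \<in> E" by (auto simp: add_edge_def)
    have "del_edge u v (add_edge x y E) = add_edge x y (del_edge u v E)"
      using False by (auto simp: add_edge_def del_edge_def)
    with nr have nr: "near (add_edge x y (del_edge u v E)) (g - 2) u v" by simp
    have sub: "near E k a b" if "near (del_edge u v E) k a b" for k a b
      using that by (rule near_subset) (auto simp: del_edge_def)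
    have uv1: "near E 1 u v" "near E 1 v u" using \<open>(u, v) \<in> E\<close> assms(2) near_arc[of _ _ E] by (auto dest: symD)
    have c: False if "near E i u x" "near E j y v" "i + j + 1 \<le> g - 2" for i j
    proof -
      have "near E (i + 1 + j) x y"
        using that uv1 near_sym[OF assms(2)] by (meson near_trans)
      with that assms(3) show False using near_mono[of E "i+1+j" x y "g-2"] by simp
    qed
    have c': False if "near E i u y" "near E j x v" "i + j + 1 \<le> g - 2" for i j
    proof -
      have "near E (j + 1 + i) x y"
        using that uv1 near_sym[OF assms(2)] by (meson near_trans)
      with that assms(3) show False using near_mono[of E "j+1+i" x y "g-2"] by simp
    qed
    from near_add_edge[OF nr] show False
      using assms(1) \<open>(u, v) \<in> E\<close> sub c c' unfolding girth_ge_def by blast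
  qed
qed

text \<open>After xu has been added, a short walk from y to v that crosses xu either contains a
  short walk from u to v avoiding the edge uv, against the girth of \<open>E\<close>, or reaches u
  from y, whence the old edge uv would have brought y close to v.\<close>

lemma girth_ge_switch:
  assumes "girth_ge g E" "sym E" "(u, v) \<in> E" "g \<ge> 3"
    and "\<not> near E (g - 2) x u" "\<not> near E (g - 2) y v"
  shows "girth_ge g (add_edge y v (add_edge x u (del_edge u v E)))"
proof -
  define E1 where "E1 = del_edge u v E"
  have s1: "sym E1" using assms(2) by (simp add: E1_def sym_del_edge)
  have sub: "E1 \<subseteq> E" by (auto simp: E1_def del_edge_def)
  have g1: "girth_ge g E1" using assms(1) sub by (rule girth_ge_subset)
  have n1: "\<not> near E1 (g - 2) x u" using assms(5) near_subset[OF _ sub] by blast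
  have g2: "girth_ge g (add_edge x u E1)" by (rule girth_ge_add_edge[OF g1 s1 n1])
  have "\<not> near (add_edge x u E1) (g - 2) y v"
  proof
    assume "near (add_edge x u E1) (g - 2) y v"
    from near_add_edge[OF this] show False
    proof (elim disjE exE conjE)
      assume "near E1 (g - 2) y v" then show False using assms(6) near_subset[OF _ sub] by blast
    next
      fix i j assume "i + j + 1 \<le> g - 2" "near E1 j u v"
      then show False using girth_geD[OF assms(1,3), of j] unfolding E1_def by linarith
    next
      fix i j assume a: "i + j + 1 \<le> g - 2" "near E1 i y u"
      then have "near E (i + 1) y v" using near_subset[OF _ sub] assms(3) near_Suc by (metis Suc_eq_plus1)
      then show False using assms(6) near_mono[of E "i+1" y v "g-2"] a by simp
    qed
  qed
  then show ?thesis using girth_ge_add_edge[OF g2 sym_add_edge[OF s1]] unfolding E1_def by blast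
qed

section \<open>Cubic completions of a skeleton\<close>

definition ball :: "'a rel \<Rightarrow> nat \<Rightarrow> 'a \<Rightarrow> 'a set" where
  "ball E k x = {y. near E k x y}"

lemma ball_mono: "j \<le> k \<Longrightarrow> ball E j x \<subseteq> ball E k x"
  by (auto simp: ball_def intro: near_mono)

text \<open>The root has at most two neighbours, and every later vertex spends one of its three
  edges on the way back to the previous ball. The levels therefore sum to at most 1 + 2 + ... +
  2^k.\<close>

lemma card_ball_le:
  assumes "finite E" "sym E" "\<And>v. card (E `` {v}) \<le> 3" "card (E `` {x}) \<le> 2"
  shows "finite (ball E k x) \<and> card (ball E k x) + 1 \<le> 2 ^ (k + 1)"
proof -
  have fin: "finite (E `` {v})" for v using assms(1) by (rule finite_Image)
  have S: "finite (ball E (Suc k) x - ball E k x) \<and> card (ball E (Suc k) x - ball E k x) \<le> 2 ^ Suc k" for k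
  proof (induction k)
    case 0
    have "ball E (Suc 0) x - ball E 0 x \<subseteq> E `` {x}" by (auto simp: ball_def near_Suc)
    with assms(4) fin card_mono[OF fin this] show ?case by (auto intro: finite_subset)
  next
    case (Suc k)
    let ?W = "ball E (Suc k) x - ball E k x"
    let ?f = "\<lambda>w. E `` {w} - ball E (Suc k) x"
    have sub: "ball E (Suc (Suc k)) x - ball E (Suc k) x \<subseteq> (\<Union>w\<in>?W. ?f w)"
    proof
      fix y assume y: "y \<in> ball E (Suc (Suc k)) x - ball E (Suc k) x"
      then obtain z where z: "near E (Suc k) x z" "z = y \<or> (z, y) \<in> E" by (auto simp: ball_def near_Suc[of E "Suc k"])
      with y have "(z, y) \<in> E" "z \<notin> ball E k x" by (auto simp: ball_def near_Suc[of E k])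
      with y z show "y \<in> (\<Union>w\<in>?W. ?f w)" by (auto simp: ball_def)
    qed
    have le: "card (?f w) \<le> 2" if "w \<in> ?W" for w
    proof -
      from that obtain z where z: "near E k x z" "(z, w) \<in> E" by (auto simp: ball_def near_Suc)
      then have "z \<in> E `` {w}" "z \<in> ball E (Suc k) x" using assms(2) ball_mono[of k "Suc k" E x]
        by (auto simp: ball_def dest: symD)
      then have "?f w \<subset> E `` {w}" by auto
      from psubset_card_mono[OF fin this] assms(3)[of w] show ?thesis by linarith
    qed
    have "card (\<Union>w\<in>?W. ?f w) \<le> (\<Sum>w\<in>?W. card (?f w))" using Suc.IH by (intro card_UN_le) auto
    also have "\<dots> \<le> card ?W * 2" using le sum_bounded_above[of ?W "\<lambda>w. card (?f w)" 2] by simp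
    also have "\<dots> \<le> 2 ^ Suc (Suc k)" using Suc.IH by simp
    finally have "card (\<Union>w\<in>?W. ?f w) \<le> 2 ^ Suc (Suc k)" .
    moreover have "finite (\<Union>w\<in>?W. ?f w)" using Suc.IH fin by auto
    ultimately show ?case using card_mono[OF _ sub] finite_subset[OF sub] by fastforce
  qed
  show ?thesis
  proof (induction k)
    case 0
    have "ball E 0 x = {x}" by (auto simp: ball_def)
    then show ?case by simp
  next
    case (Suc k)
    have "ball E (Suc k) x = ball E k x \<union> (ball E (Suc k) x - ball E k x)"
      using ball_mono[of k "Suc k" E x] by auto
    then have "card (ball E (Suc k) x) = card (ball E k x) + card (ball E (Suc k) x - ball E k x)"
      "finite (ball E (Suc k) x)"
      using Suc S[of k] by (metis card_Un_disjoint Diff_disjoint, metis finite_Un)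
    then show ?case using Suc S[of k] by simp
  qed
qed

lemma even_card_sym_irrefl:
  fixes E :: "'a::linorder rel"
  assumes "finite E" "sym E" "irrefl E"
  shows "even (card E)"
proof -
  let ?A = "{(u, v). (u, v) \<in> E \<and> u < v}"
  have fin: "finite ?A" using assms(1) by (rule finite_subset[rotated]) auto
  have eq: "?A \<union> ?A\<inverse> = E"
  proof
    show "?A \<union> ?A\<inverse> \<subseteq> E" using assms(2) by (auto dest: symD)
    show "E \<subseteq> ?A \<union> ?A\<inverse>"
    proof (rule subrelI)
      fix u v assume "(u, v) \<in> E"
      then show "(u, v) \<in> ?A \<union> ?A\<inverse>"
        using assms(2,3) by (cases u v rule: linorder_cases) (auto simp: irrefl_def dest: symD)
    qed
  qed
  have "card (?A \<union> ?A\<inverse>) = card ?A + card (?A\<inverse>)"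
    using fin by (intro card_Un_disjoint) auto
  then have "card E = 2 * card ?A" unfolding eq by simp
  then show ?thesis by simp
qed

lemma card_eq_sum_degrees:
  assumes "finite V" "E \<subseteq> V \<times> V"
  shows "card E = (\<Sum>v\<in>V. card (E `` {v}))"
proof -
  have "E = (SIGMA v:V. E `` {v})" using assms(2) by auto
  moreover have "finite (E `` {v})" for v using assms by (meson finite_Image finite_SigmaI finite_subset)
  ultimately show ?thesis using card_SigmaI[of V "\<lambda>v. E `` {v}"] assms(1) by metis
qed

lemma add_edge_Image:
  "add_edge x y E `` {v} = E `` {v} \<union> (if v = x then {y} else {}) \<union> (if v = y then {x} else {})"
  by (auto simp: add_edge_def)

lemma card_del_edge_Image:
  assumes "finite E" "(u, v) \<in> E" "(v, u) \<in> E" "u \<noteq> v" "t = u \<or> t = v"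
  shows "card (del_edge u v E `` {t}) < card (E `` {t})"
proof (rule psubset_card_mono)
  show "finite (E `` {t})" using assms(1) by (rule finite_Image)
  show "del_edge u v E `` {t} \<subset> E `` {t}" using assms by (auto simp: del_edge_def)
qed

definition subcubic_extension :: "nat \<Rightarrow> 'a set \<Rightarrow> 'a rel \<Rightarrow> 'a rel \<Rightarrow> bool" where
  "subcubic_extension g V S E \<longleftrightarrow> S \<subseteq> E \<and> E \<subseteq> V \<times> V \<and> sym E \<and> irrefl E \<and>
     (\<forall>v. card (E `` {v}) \<le> 3) \<and> girth_ge g E"

lemma subcubic_extension_add_edge:
  assumes E: "subcubic_extension g V S E" and V: "finite V" "x \<in> V" "y \<in> V"
    and d: "card (E `` {x}) \<le> 2" "card (E `` {y}) \<le> 2" "x \<noteq> y"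
    and n: "\<not> near E (g - 2) x y" "g \<ge> 3"
  shows "\<exists>E'. subcubic_extension g V S E' \<and> card E < card E'"
proof (intro exI conjI)
  let ?E = "add_edge x y E"
  have fE: "finite E" using E V(1) finite_subset[of E "V \<times> V"] by (auto simp: subcubic_extension_def)
  have g2: "1 \<le> g - 2" using n by simp
  have "(x, y) \<notin> E" using n near_arc_mono[OF _ g2] by metis
  then show "card E < card ?E"
    using fE by (intro psubset_card_mono) (auto simp: add_edge_def)
  have "card (?E `` {v}) \<le> 3" for v
  proof -
    have "card (?E `` {v}) \<le> card (E `` {v} \<union> (if v = x then {y} else {})) + card (if v = y then {x} else {})"
      unfolding add_edge_Image by (rule card_Un_le)
    also have "\<dots> \<le> card (E `` {v}) + card (if v = x then {y} else {}) + card (if v = y then {x} else {})"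
      by (intro add_right_mono card_Un_le)
    also have "\<dots> \<le> 3" using d E by (auto simp: subcubic_extension_def)
    finally show ?thesis .
  qed
  moreover have "girth_ge g ?E" using E n by (intro girth_ge_add_edge) (auto simp: subcubic_extension_def)
  ultimately show "subcubic_extension g V S ?E"
    using E V d unfolding subcubic_extension_def
    by (auto simp: sym_add_edge) (auto simp: add_edge_def irrefl_def)
qed

lemma card_Un5_le:
  "card (A \<union> B \<union> C \<union> D \<union> F) \<le> card A + card B + card C + card D + card F"
  using card_Un_le[of "A \<union> B \<union> C \<union> D" F] card_Un_le[of "A \<union> B \<union> C" D] card_Un_le[of "A \<union> B" C]
    card_Un_le[of A B] by linarith

text \<open>The edge uv gives way to xu and yv: u and v keep their degrees, x and y gain one each,
  and two arcs are replaced by four.\<close>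

lemma subcubic_extension_switch:
  assumes E: "subcubic_extension g V S E" and V: "finite V" "x \<in> V" "y \<in> V"
    and d: "card (E `` {x}) \<le> 2" "card (E `` {y}) \<le> 2" "x \<noteq> y"
    and uv: "(u, v) \<in> E" "(u, v) \<notin> S" "(v, u) \<notin> S" "u \<noteq> y" "v \<noteq> x"
    and n: "\<not> near E (g - 2) x u" "\<not> near E (g - 2) y v" "g \<ge> 3"
  shows "\<exists>E'. subcubic_extension g V S E' \<and> card E < card E'"
proof (intro exI conjI)
  let ?D = "del_edge u v E"
  let ?E = "add_edge y v (add_edge x u ?D)"
  have fE: "finite E" using E V(1) finite_subset[of E "V \<times> V"] by (auto simp: subcubic_extension_def)
  have sE: "sym E" and iE: "irrefl E" using E by (auto simp: subcubic_extension_def)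
  have vu: "(v, u) \<in> E" using uv(1) sE by (auto dest: symD)
  have ne: "u \<noteq> v" "u \<noteq> x" "v \<noteq> y" using uv iE n by (auto simp: irrefl_def)
  have g2: "1 \<le> g - 2" using n by simp
  have nE: "(x, u) \<notin> E" "(y, v) \<notin> E" using n near_arc_mono[OF _ g2] by metis+
  then have nE': "(u, x) \<notin> E" "(v, y) \<notin> E" using sE by (auto dest: symD)
  have cD: "card ?D + 2 = card E"
  proof -
    have "card ?D = card E - card {(u, v), (v, u)}"
      unfolding del_edge_def using uv vu by (intro card_Diff_subset) auto
    moreover have "card {(u, v), (v, u)} \<le> card E" using fE uv vu by (intro card_mono) auto
    ultimately show ?thesis using ne by simp
  qed
  have "?E = ?D \<union> {(x, u), (u, x), (y, v), (v, y)}" by (auto simp: add_edge_def)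
  moreover have "?D \<inter> {(x, u), (u, x), (y, v), (v, y)} = {}" using nE nE' by (auto simp: del_edge_def)
  moreover have "card {(x, u), (u, x), (y, v), (v, y)} = 4" using ne d uv by auto
  moreover have "finite ?D" using fE by (auto simp: del_edge_def)
  ultimately have "card ?E = card ?D + 4" using card_Un_disjoint[of ?D "{(x, u), (u, x), (y, v), (v, y)}"] by (simp del: insert_iff Un_insert_right)
  then show "card E < card ?E" using cD by simp
  have "card (?E `` {t}) \<le> 3" for t
  proof -
    have le: "card (?D `` {t}) \<le> card (E `` {t})"
      using fE by (intro card_mono) (auto simp: del_edge_def)
    have lt: "card (?D `` {t}) < card (E `` {t})" if "t = u \<or> t = v"
      using card_del_edge_Image[OF fE uv(1) vu ne(1) that] .
    have E3: "card (E `` {t}) \<le> 3" using E by (auto simp: subcubic_extension_def)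
    have "card (?E `` {t}) \<le> card (?D `` {t}) + card (if t = x then {u} else {}) + card (if t = u then {x} else {})
        + card (if t = y then {v} else {}) + card (if t = v then {y} else {})"
      unfolding add_edge_Image by (rule card_Un5_le)
    also have "\<dots> \<le> 3" 
    proof -
      consider "t = x" | "t = y" | "t = u" | "t = v" | "t \<noteq> x" "t \<noteq> y" "t \<noteq> u" "t \<noteq> v" by blast
      then show ?thesis
      proof cases
        case 1
        have "t \<noteq> u" "t \<noteq> v" "t \<noteq> y" using 1 ne uv d(3) by blast+
        then show ?thesis using 1 le d(1) by simp
      next
        case 2
        have "t \<noteq> u" "t \<noteq> v" "t \<noteq> x" using 2 ne uv d(3) by blast+
        then show ?thesis using 2 le d(2) by simp
      next
        case 3
        have "t \<noteq> x" "t \<noteq> v" "t \<noteq> y" using 3 ne uv d(3) by blast+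
        then show ?thesis using 3 lt E3 by simp
      next
        case 4
        have "t \<noteq> x" "t \<noteq> u" "t \<noteq> y" using 4 ne uv d(3) by blast+
        then show ?thesis using 4 lt E3 by simp
      next
        case 5
        then show ?thesis using le E3 by simp
      qed
    qed
    finally show ?thesis .
  qed
  moreover have "girth_ge g ?E"
    using E n uv(1) girth_ge_switch[OF _ sE] unfolding subcubic_extension_def by blast
  moreover have "S \<subseteq> ?E" using E uv by (auto simp: subcubic_extension_def add_edge_def del_edge_def)
  moreover have "?E \<subseteq> V \<times> V" using E uv V by (auto simp: subcubic_extension_def add_edge_def del_edge_def)
  moreover have "irrefl ?E" using iE ne by (auto simp: irrefl_def add_edge_def del_edge_def)
  ultimately show "subcubic_extension g V S ?E"
    unfolding subcubic_extension_def using sE by (simp add: sym_add_edge sym_del_edge)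
qed

text \<open>
  Let $x$, $y$ have degree 2. If some vertex of degree 2 is far from $x$, join the two. Otherwise all of
  them lie in the ball around $x$, and an edge $wp$ outside the skeleton with $w$ in neither ball can be
  replaced by $xw$, $yp$ (or $xp$, $yw$) unless $p$ lies in both balls. If every such
  $p$ lay in both balls, the balls would overlap so much that too few vertices could be free.
\<close>
lemma subcubic_extension_grow:
  fixes V :: "'a::linorder set"
  assumes E: "subcubic_extension g V S E" and V: "finite V" "even (card V)" and g: "g \<ge> 5"
    and S: "sym S" "\<And>v. v \<in> V \<Longrightarrow> card (S `` {v}) \<ge> 2"
    and F: "2 ^ g \<le> card {v \<in> V. card (S `` {v}) = 2} + 4"
    and x: "x \<in> V" "card (E `` {x}) \<noteq> 3"
  shows "\<exists>E'. subcubic_extension g V S E' \<and> card E < card E'"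
proof -
  have E': "S \<subseteq> E" "E \<subseteq> V \<times> V" "sym E" "irrefl E" "\<And>v. card (E `` {v}) \<le> 3" "girth_ge g E"
    using E by (auto simp: subcubic_extension_def)
  have fE: "finite E" using E'(2) V(1) by (meson finite_SigmaI finite_subset)
  have fI: "finite (E `` {v})" for v using fE by (rule finite_Image)
  have d2: "card (E `` {v}) \<ge> 2" if "v \<in> V" for v
    using S(2)[OF that] card_mono[OF fI, of "S `` {v}" v] E'(1) by fastforce
  have dx: "card (E `` {x}) = 2" using x d2[of x] E'(5)[of x] by linarith
  \<comment> \<open>Parity: if x were the only vertex of degree 2, the number of arcs would be 2 +
    3(|V| - 1), which is odd for even |V|.\<close>
  have "\<exists>y\<in>V. y \<noteq> x \<and> card (E `` {y}) = 2"
  proof (rule ccontr)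
    assume none: "\<not> ?thesis"
    have "card (E `` {v}) = 3" if "v \<in> V - {x}" for v
      using that d2[of v] E'(5)[of v] none by (cases "card (E `` {v}) = 2") auto
    then have "card E = 2 + 3 * (card V - 1)"
      using card_eq_sum_degrees[OF V(1) E'(2)] sum.remove[OF V(1) x(1), of "\<lambda>v. card (E `` {v})"] dx x(1) V(1) by simp
    moreover have "card V \<ge> 1" using x(1) V(1) by (metis One_nat_def Suc_leI card_gt_0_iff empty_iff)
    ultimately show False using even_card_sym_irrefl[OF fE E'(3,4)] V(2) by auto
  qed
  then obtain y where y: "y \<in> V" "y \<noteq> x" "card (E `` {y}) = 2" by blast
  have g2: "1 \<le> g - 2" using g by simp
  let ?X = "ball E (g - 2) x" and ?Y = "ball E (g - 2) y"
  show ?thesis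
  proof (cases "\<exists>z\<in>V. z \<noteq> x \<and> card (E `` {z}) = 2 \<and> \<not> near E (g - 2) x z")
    case True
    then obtain z where "z \<in> V" "z \<noteq> x" "card (E `` {z}) = 2" "\<not> near E (g - 2) x z" by blast
    then show ?thesis using subcubic_extension_add_edge[OF E V(1) x(1), of z] dx g by auto
  next
    case False
    then have nxy: "near E (g - 2) x y" using y by blast
    let ?F = "{v \<in> V. card (S `` {v}) = 2}"
    let ?W = "?F - (?X \<union> ?Y)"
    \<comment> \<open>In this case every vertex of degree 2 in \<open>E\<close> is near x. Hence w,
      being far from x, has degree 3 in \<open>E\<close> but 2 in \<open>S\<close>.\<close>
    have "\<exists>p. (w, p) \<in> E \<and> (w, p) \<notin> S" if w: "w \<in> ?W" for w
    proof -
      have "w \<noteq> x" using w by (auto simp: ball_def)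
      with w False d2[of w] E'(5)[of w] have "card (E `` {w}) = 3" by (auto simp: ball_def)
      with w have "E `` {w} \<noteq> S `` {w}" by auto
      with E'(1) show ?thesis by auto
    qed
    then have "\<forall>w\<in>?W. \<exists>q. (w, q) \<in> E \<and> (w, q) \<notin> S" by blast
    from bchoice[OF this] obtain p where p: "\<And>w. w \<in> ?W \<Longrightarrow> (w, p w) \<in> E \<and> (w, p w) \<notin> S" by blast
    show ?thesis
    proof (cases "\<exists>w\<in>?W. p w \<notin> ?X \<inter> ?Y")
      case True
      then obtain w where w: "w \<in> ?W" "p w \<notin> ?X \<inter> ?Y" by blast
      have nw: "\<not> near E (g - 2) x w" "\<not> near E (g - 2) y w" using w by (auto simp: ball_def)
      have wp: "(w, p w) \<in> E" "(w, p w) \<notin> S" "(p w, w) \<in> E" "(p w, w) \<notin> S"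
        using p[OF w(1)] E'(3) S(1) by (auto dest: symD)
      have ne: "p w \<noteq> x" "p w \<noteq> y"
        using nw wp near_arc_mono[OF _ g2] by metis+
      have "w \<noteq> x" "w \<noteq> y" using nw by auto
      from w consider "\<not> near E (g - 2) y (p w)" | "\<not> near E (g - 2) x (p w)" by (auto simp: ball_def)
      then show ?thesis
      proof cases
        case 1
        then show ?thesis
          using subcubic_extension_switch[OF E V(1) x(1) y(1), of w "p w"] dx y nw wp ne g \<open>w \<noteq> y\<close> by auto
      next
        case 2
        then show ?thesis
          using subcubic_extension_switch[OF E V(1) x(1) y(1), of "p w" w] dx y nw wp ne g \<open>w \<noteq> x\<close> by auto
      qed
    next
      case False
      have Sp: "p w \<in> V" "(w, p w) \<in> E" "(w, p w) \<notin> S" "(p w, w) \<in> E" "(p w, w) \<notin> S" if "w \<in> ?W" for w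
        using p[OF that] E'(2,3) S(1) by (auto dest: symD)
      \<comment> \<open>Skeleton degree at least 2 leaves each vertex room for only one edge outside
        \<open>S\<close>, so \<open>p w\<close> determines w.\<close>
      have inj: "inj_on p ?W"
      proof (rule inj_onI)
        fix w w' assume w: "w \<in> ?W" "w' \<in> ?W" "p w = p w'"
        show "w = w'"
        proof (rule ccontr)
          assume "w \<noteq> w'"
          have sub: "S `` {p w} \<union> {w, w'} \<subseteq> E `` {p w}" using Sp[OF w(1)] Sp[OF w(2)] w(3) E'(1) by auto
          have "card (S `` {p w} \<union> {w, w'}) \<le> 3" using card_mono[OF fI sub] E'(5)[of "p w"] by linarith
          moreover have "card (S `` {p w} \<union> {w, w'}) = card (S `` {p w}) + card {w, w'}"
          proof (rule card_Un_disjoint)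
            show "finite (S `` {p w})" using E'(1) fE by (meson finite_Image finite_subset)
            show "S `` {p w} \<inter> {w, w'} = {}" using Sp[OF w(1)] Sp[OF w(2)] w(3) by auto
          qed auto
          ultimately show False using S(2)[OF Sp(1)[OF w(1)]] \<open>w \<noteq> w'\<close> by simp
        qed
      qed
      \<comment> \<open>A third vertex, after x and y, that lies in both balls and yet is no
        \<open>p w\<close>: as a neighbour of x it would bring w within distance 2 of x.\<close>
      have "\<exists>z. (x, z) \<in> E \<and> z \<noteq> y \<and> near E (g - 2) y z"
      proof (cases "(x, y) \<in> E")
        case True
        have "\<not> E `` {x} \<subseteq> {y}" using card_mono[of "{y}" "E `` {x}"] dx by auto
        then obtain z where z: "(x, z) \<in> E" "z \<noteq> y" by auto
        have "near E 2 y z" using True z E'(3) near_Suc2[of E 1 y z] near_arc[of x z E]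
          by (auto simp: numeral_2_eq_2 dest: symD)
        then show ?thesis using z near_mono[of E 2 y z "g - 2"] g by auto
      next
        case False
        have *: "\<exists>z. (x, z) \<in> E \<and> near E (k - 1) z y" if "near E k x y" for k
          using that
        proof (induction k)
          case (Suc k)
          then obtain z where "x = z \<or> (x, z) \<in> E" "near E k z y" unfolding near_Suc2 by blast
          then show ?case using Suc.IH near_mono[of E "k - 1" _ y k] by (cases "x = z") auto
        qed (use y in auto)
        then obtain z where z: "(x, z) \<in> E" "near E (g - 2 - 1) z y" using nxy by blast
        then show ?thesis using False near_mono[of E "g - 2 - 1" z y "g - 2"] near_sym[OF E'(3)] by auto
      qed
      then obtain z where z: "(x, z) \<in> E" "z \<noteq> y" "near E (g - 2) y z" by blast
      have "z \<noteq> x" using z E'(4) by (auto simp: irrefl_def)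
      have far: "p w \<noteq> t" if "w \<in> ?W" "near E 1 x t \<or> near E 1 y t" for w t
      proof
        assume "p w = t"
        then have "near E 2 x w \<or> near E 2 y w" using that Sp[OF that(1)] near_Suc[of E 1 _ w]
          by (auto simp: numeral_2_eq_2)
        then show False using that(1) g near_mono[of E 2 _ w "g - 2"] by (auto simp: ball_def)
      qed
      have sub: "p ` ?W \<subseteq> ?X \<inter> ?Y - {x, y, z}"
        using False far[of _ x] far[of _ y] far[of _ z] near_arc[OF z(1)] by auto
      have g1: "g - 2 + 1 = g - 1" using g by simp
      have bX: "finite ?X" "card ?X + 1 \<le> 2 ^ (g - 1)"
        using card_ball_le[OF fE E'(3,5), of x "g - 2", unfolded g1] dx by linarith+
      have bY: "finite ?Y" "card ?Y + 1 \<le> 2 ^ (g - 1)"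
        using card_ball_le[OF fE E'(3,5), of y "g - 2", unfolded g1] y(3) by linarith+
      have xyz: "{x, y, z} \<subseteq> ?X \<inter> ?Y"
        using z nxy near_sym[OF E'(3)] near_arc_mono[OF z(1) g2] by (auto simp: ball_def)
      have c3: "card {x, y, z} = 3" using \<open>z \<noteq> x\<close> z(2) y(2) by auto
      have fXY: "finite (?X \<inter> ?Y)" using bX(1) by blast
      have "card ?W = card (p ` ?W)" by (rule card_image[OF inj, symmetric])
      also have "\<dots> \<le> card (?X \<inter> ?Y - {x, y, z})" using fXY by (intro card_mono[OF _ sub]) blast
      also have "\<dots> = card (?X \<inter> ?Y) - 3"
        using card_Diff_subset[OF _ xyz] c3 by (metis finite.emptyI finite_insert)
      finally have W: "card ?W \<le> card (?X \<inter> ?Y) - 3" .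
      have "3 \<le> card (?X \<inter> ?Y)" using card_mono[OF fXY xyz] c3 by linarith
      moreover have "card (?X \<union> ?Y) + card (?X \<inter> ?Y) = card ?X + card ?Y"
        using card_Un_Int[OF bX(1) bY(1)] by simp
      moreover have "card ?F \<le> card ?W + card (?X \<union> ?Y)"
      proof -
        have "card ?F \<le> card (?W \<union> (?X \<union> ?Y))"
        proof (rule card_mono)
          show "finite (?W \<union> (?X \<union> ?Y))" using V(1) bX(1) bY(1) by simp
        qed blast
        then show ?thesis using card_Un_le[of ?W "?X \<union> ?Y"] by linarith
      qed
      \<comment> \<open>Each ball has at most 2^(g-1) - 1 vertices, and three common ones are not of
        the form \<open>p w\<close>. This leaves at most 2^g - 5 free vertices, one fewer than
        assumed.\<close>
      ultimately have "card ?F + 5 \<le> 2 * 2 ^ (g - 1)" using W bX(2) bY(2) by linarith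
      also have "\<dots> = 2 ^ g" using g by (cases g) auto
      finally show ?thesis using F by linarith
    qed
  qed
qed

text \<open>Extensions have at most |V|^2 arcs, so one with the most arcs exists; a vertex of degree
  other than 3 would allow it to grow.\<close>

theorem cubic_extension:
  fixes V :: "'a::linorder set"
  assumes V: "finite V" "even (card V)" and g: "g \<ge> 5"
    and S: "sym S" "irrefl S" "S \<subseteq> V \<times> V" "\<And>v. v \<in> V \<Longrightarrow> card (S `` {v}) \<in> {2, 3}" "girth_ge g S"
    and F: "2 ^ g \<le> card {v \<in> V. card (S `` {v}) = 2} + 4"
  obtains E where "S \<subseteq> E" "E \<subseteq> V \<times> V" "sym E" "irrefl E" "\<And>v. v \<in> V \<Longrightarrow> card (E `` {v}) = 3" "girth_ge g E"
proof -
  have "card (S `` {v}) \<le> 3" for v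
  proof (cases "v \<in> V")
    case False
    then have "S `` {v} = {}" using S(3) by auto
    then show ?thesis by simp
  qed (use S(4) in fastforce)
  then have "subcubic_extension g V S S" using S by (auto simp: subcubic_extension_def)
  moreover have "card E < Suc (card (V \<times> V))" if "subcubic_extension g V S E" for E
    using that V(1) unfolding subcubic_extension_def less_Suc_eq_le by (intro card_mono) auto
  ultimately obtain E where E: "subcubic_extension g V S E"
    and max: "\<And>E'. subcubic_extension g V S E' \<Longrightarrow> card E' \<le> card E"
    using ex_has_greatest_nat[of "subcubic_extension g V S" S card] less_Suc_eq_le by metis
  have S2: "card (S `` {v}) \<ge> 2" if "v \<in> V" for v using S(4)[OF that] by auto
  have "card (E `` {v}) = 3" if "v \<in> V" for v
    using subcubic_extension_grow[OF E V g S(1) S2 F that] max not_less by blast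
  with E show ?thesis using that by (auto simp: subcubic_extension_def)
qed

section \<open>A Moore bound for sets with few leaving edges\<close>

text \<open>A walk of at most g - 2 steps that returned to v without the edge vw would close up with
  this edge to a cycle shorter than g.\<close>

lemma near_avoid:
  assumes "girth_ge g E" "sym E" "(v, w) \<in> E" "v \<noteq> w"
  shows "r + 2 \<le> g \<Longrightarrow> near (del_edge v w E) r w p \<Longrightarrow> p \<noteq> v \<and> near {(a, b) \<in> E. a \<noteq> v \<and> b \<noteq> v} r w p"
proof (induction r arbitrary: p)
  case 0
  then show ?case using assms(4) by auto
next
  case (Suc r)
  from Suc.prems obtain z where z: "near (del_edge v w E) r w z" "z = p \<or> (z, p) \<in> del_edge v w E"
    by (auto simp: near_Suc)
  have IH: "z \<noteq> v" "near {(a, b) \<in> E. a \<noteq> v \<and> b \<noteq> v} r w z" using Suc.IH z(1) Suc.prems(1) by auto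
  have "p \<noteq> v"
  proof
    assume "p = v"
    have "(w, v) \<in> E" using assms(2,3) by (auto dest: symD)
    moreover have "near (del_edge w v E) (Suc r) w v" using Suc.prems(2) \<open>p = v\<close> by (simp add: del_edge_commute)
    ultimately show False using girth_geD[OF assms(1)] Suc.prems(1) by fastforce
  qed
  moreover have "near {(a, b) \<in> E. a \<noteq> v \<and> b \<noteq> v} (Suc r) w p"
    using IH z(2) \<open>p \<noteq> v\<close> unfolding near_Suc del_edge_def by blast
  ultimately show ?case by blast
qed

text \<open>The part of the Moore tree behind the arc from u to v, down to depth r below v.\<close>

definition branch :: "'a rel \<Rightarrow> nat \<Rightarrow> 'a \<Rightarrow> 'a \<Rightarrow> 'a set" where
  "branch E r u v = ball (del_edge u v E) r v"

context
  fixes g :: nat and V :: "'a set" and E :: "'a rel" and T :: "'a set"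
  assumes girth: "girth_ge g E" and symE: "sym E" and irr: "irrefl E"
    and EV: "E \<subseteq> V \<times> V" and finV: "finite V"
    and T: "T \<subseteq> V" "\<And>v. v \<in> T \<Longrightarrow> card (E `` {v}) = 2" "\<And>v. v \<in> V - T \<Longrightarrow> card (E `` {v}) = 3"
begin

lemma branch_subset: "v \<in> V \<Longrightarrow> branch E r u v \<subseteq> V"
proof
  fix p assume "v \<in> V" "p \<in> branch E r u v"
  then have "near (del_edge u v E) r v p" by (simp add: branch_def ball_def)
  then have "near E r v p" by (rule near_subset) (auto simp: del_edge_def)
  then show "p \<in> V" using \<open>v \<in> V\<close> EV by (induction r arbitrary: p) (auto simp: near_Suc)
qed

lemma finite_branch: "(u, v) \<in> E \<Longrightarrow> finite (branch E r u v)"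
  using branch_subset[of v r u] finV EV by (auto intro: finite_subset)

lemma branch_Suc:
  assumes "(u, v) \<in> E" "r + 2 \<le> g" "w \<in> E `` {v} - {u}"
  shows "branch E r v w \<subseteq> branch E (Suc r) u v - {v}"
proof
  fix p assume "p \<in> branch E r v w"
  then have "near (del_edge v w E) r w p" by (simp add: branch_def ball_def)
  moreover have "v \<noteq> w" "u \<noteq> v" using assms irr by (auto simp: irrefl_def)
  ultimately have p: "p \<noteq> v" "near {(a, b) \<in> E. a \<noteq> v \<and> b \<noteq> v} r w p"
    using near_avoid[OF girth symE _ _ assms(2), of v w p] assms(3) by auto
  from p(2) have "near (del_edge u v E) r w p" by (rule near_subset) (auto simp: del_edge_def)
  moreover have "(v, w) \<in> del_edge u v E" using assms \<open>u \<noteq> v\<close> by (auto simp: del_edge_def)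
  ultimately have "near (del_edge u v E) (Suc r) v p" by (rule near_step2[rotated])
  then show "p \<in> branch E (Suc r) u v - {v}" using p(1) by (simp add: branch_def ball_def)
qed

text \<open>A common vertex would join w to w' by at most 2r steps away from v, and the two edges at
  v would complete a cycle of length at most 2r + 2.\<close>

lemma branch_disjoint:
  assumes "(v, w) \<in> E" "(v, w') \<in> E" "w \<noteq> w'" "2 * r + 3 \<le> g"
  shows "branch E r v w \<inter> branch E r v w' = {}"
proof (rule ccontr)
  assume "\<not> ?thesis"
  then obtain p where p: "near (del_edge v w E) r w p" "near (del_edge v w' E) r w' p"
    by (auto simp: branch_def ball_def)
  have ne: "v \<noteq> w" "v \<noteq> w'" using assms irr by (auto simp: irrefl_def)
  let ?E = "{(a, b) \<in> E. a \<noteq> v \<and> b \<noteq> v}"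
  have "near ?E r w p" "near ?E r w' p"
    using near_avoid[OF girth symE assms(1) ne(1) _ p(1)] near_avoid[OF girth symE assms(2) ne(2) _ p(2)] assms(4) by auto
  moreover have "sym ?E" using symE by (auto simp: sym_def)
  ultimately have "near ?E (r + r) w w'" using near_trans[of ?E r w p r w'] near_sym[of ?E r w' p] by blast
  then have "near (del_edge w v E) (r + r) w w'" by (rule near_subset) (auto simp: del_edge_def)
  moreover have "(w', v) \<in> del_edge w v E" using assms symE ne by (auto simp: del_edge_def dest: symD)
  ultimately have "near (del_edge w v E) (Suc (r + r)) w v" by (rule near_step)
  moreover have "(w, v) \<in> E" using assms(1) symE by (auto dest: symD)
  ultimately show False using girth_geD[OF girth] assms(4) by fastforce
qed

lemma other_neighbours:
  assumes "(u, v) \<in> E"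
  shows "v \<in> T \<Longrightarrow> \<exists>w. E `` {v} - {u} = {w}"
    and "v \<notin> T \<Longrightarrow> \<exists>w w'. w \<noteq> w' \<and> E `` {v} - {u} = {w, w'}"
proof -
  have u: "u \<in> E `` {v}" using assms symE by (auto dest: symD)
  have v: "v \<in> V" using assms EV by auto
  have c: "card (E `` {v} - {u}) = card (E `` {v}) - 1" by (rule card_Diff_singleton[OF u])
  show "\<exists>w. E `` {v} - {u} = {w}" if "v \<in> T"
  proof -
    have "card (E `` {v} - {u}) = 1" unfolding c using T(2)[OF that] by simp
    then show ?thesis by (rule card_1_singletonE) blast
  qed
  show "\<exists>w w'. w \<noteq> w' \<and> E `` {v} - {u} = {w, w'}" if "v \<notin> T"
  proof -
    have "card (E `` {v} - {u}) = 2" unfolding c using T(3)[of v] that v by simp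
    then show ?thesis unfolding card_2_iff by blast
  qed
qed

lemma card_branch_two:
  assumes "(u, v) \<in> E" "2 * r + 3 \<le> g" "E `` {v} - {u} = {w, w'}" "w \<noteq> w'"
  shows "card (branch E r v w) + card (branch E r v w') < card (branch E (Suc r) u v)"
    and "card (branch E r v w \<inter> T) + card (branch E r v w' \<inter> T) \<le> card (branch E (Suc r) u v \<inter> T)"
proof -
  have ww: "(v, w) \<in> E" "(v, w') \<in> E" "w \<in> E `` {v} - {u}" "w' \<in> E `` {v} - {u}" using assms(3) by auto
  have fin: "finite (branch E r v w)" "finite (branch E r v w')" "finite (branch E (Suc r) u v)"
    by (rule finite_branch[OF ww(1)], rule finite_branch[OF ww(2)], rule finite_branch[OF assms(1)])
  have d: "branch E r v w \<inter> branch E r v w' = {}" using branch_disjoint[OF ww(1,2) assms(4,2)] .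
  have r: "r + 2 \<le> g" using assms(2) by simp
  have sub: "branch E r v w \<union> branch E r v w' \<subseteq> branch E (Suc r) u v - {v}"
    using branch_Suc[OF assms(1) r ww(3)] branch_Suc[OF assms(1) r ww(4)] by (rule Un_least)
  have v: "v \<in> branch E (Suc r) u v" by (simp add: branch_def ball_def)
  have "card (branch E r v w) + card (branch E r v w') = card (branch E r v w \<union> branch E r v w')"
    using card_Un_disjoint[OF fin(1,2) d] by simp
  also have "\<dots> < card (branch E (Suc r) u v)"
    by (rule psubset_card_mono[OF fin(3)]) (use v sub in blast)
  finally show "card (branch E r v w) + card (branch E r v w') < card (branch E (Suc r) u v)" .
  have "card (branch E r v w \<inter> T) + card (branch E r v w' \<inter> T) = card (branch E r v w \<inter> T \<union> branch E r v w' \<inter> T)"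
    by (rule card_Un_disjoint[symmetric]) (use fin(1,2) d in blast)+
  also have "\<dots> \<le> card (branch E (Suc r) u v \<inter> T)"
    by (rule card_mono) (use fin(3) sub in blast)+
  finally show "card (branch E r v w \<inter> T) + card (branch E r v w' \<inter> T) \<le> card (branch E (Suc r) u v \<inter> T)" .
qed

lemma card_branch_one:
  assumes "(u, v) \<in> E" "2 * r + 3 \<le> g" "w \<in> E `` {v} - {u}"
  shows "card (branch E r v w) < card (branch E (Suc r) u v)"
    and "v \<in> T \<Longrightarrow> card (branch E r v w \<inter> T) < card (branch E (Suc r) u v \<inter> T)"
proof -
  have fin: "finite (branch E (Suc r) u v)" by (rule finite_branch[OF assms(1)])
  have r: "r + 2 \<le> g" using assms(2) by simp
  have sub: "branch E r v w \<subseteq> branch E (Suc r) u v - {v}" by (rule branch_Suc[OF assms(1) r assms(3)])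
  have v: "v \<in> branch E (Suc r) u v" by (simp add: branch_def ball_def)
  show "card (branch E r v w) < card (branch E (Suc r) u v)"
    by (rule psubset_card_mono[OF fin]) (use v sub in blast)
  show "card (branch E r v w \<inter> T) < card (branch E (Suc r) u v \<inter> T)" if "v \<in> T"
    by (rule psubset_card_mono) (use fin v sub that in blast)+
qed

lemma card_branch_ge: "(u, v) \<in> E \<Longrightarrow> 2 * r + 1 \<le> g \<Longrightarrow> r < card (branch E r u v)"
proof (induction r arbitrary: u v)
  case 0
  have "branch E 0 u v = {v}" by (auto simp: branch_def ball_def)
  then show ?case by simp
next
  case (Suc r)
  obtain w where w: "w \<in> E `` {v} - {u}"
    using other_neighbours[OF Suc.prems(1)] by (cases "v \<in> T") auto
  then have "r < card (branch E r v w)" using Suc.IH[of v w] Suc.prems by auto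
  then show ?case using card_branch_one(1)[OF Suc.prems(1) _ w, of r] Suc.prems(2) by simp
qed

text \<open>If no vertex of the branch lies in \<open>T\<close>, it contains a full binary tree with
  2^(r+1) - 1 vertices. A vertex of \<open>T\<close> has one child in place of two, which costs at
  most a factor 2 in the size plus one.\<close>

lemma card_branch_ge_power:
  "(u, v) \<in> E \<Longrightarrow> 2 * r + 1 \<le> g \<Longrightarrow> 2 ^ (r + 1) \<le> (card (branch E r u v) + 1) * 2 ^ card (branch E r u v \<inter> T)"
proof (induction r arbitrary: u v)
  case 0
  have "branch E 0 u v = {v}" by (auto simp: branch_def ball_def)
  then have c: "card (branch E 0 u v) + 1 = 2" by simp
  have "(2::nat) * 1 \<le> 2 * 2 ^ card (branch E 0 u v \<inter> T)" by (intro mult_le_mono) simp_all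
  then show ?case unfolding c by simp
next
  case (Suc r)
  let ?B = "card (branch E (Suc r) u v)" and ?t = "card (branch E (Suc r) u v \<inter> T)"
  have g: "2 * r + 3 \<le> g" using Suc.prems(2) by simp
  show ?case
  proof (cases "v \<in> T")
    case True
    obtain w where w: "w \<in> E `` {v} - {u}" using other_neighbours(1)[OF Suc.prems(1) True] by blast
    let ?b = "card (branch E r v w)" and ?s = "card (branch E r v w \<inter> T)"
    have "2 ^ (r + 1) \<le> (?b + 1) * 2 ^ ?s" using Suc.IH[of v w] w g by auto
    then have "2 ^ (Suc r + 1) \<le> (?b + 1) * 2 ^ Suc ?s" by simp
    also have "\<dots> \<le> (?B + 1) * 2 ^ ?t"
      using card_branch_one[OF Suc.prems(1) g w] True by (intro mult_le_mono power_increasing) auto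
    finally show ?thesis .
  next
    case False
    obtain w w' where w: "w \<noteq> w'" "E `` {v} - {u} = {w, w'}" using other_neighbours(2)[OF Suc.prems(1) False] by blast
    note two = card_branch_two[OF Suc.prems(1) g w(2,1)]
    let ?b = "card (branch E r v w)" and ?s = "card (branch E r v w \<inter> T)"
    let ?b' = "card (branch E r v w')" and ?s' = "card (branch E r v w' \<inter> T)"
    have "2 ^ (r + 1) \<le> (?b + 1) * 2 ^ ?s" "2 ^ (r + 1) \<le> (?b' + 1) * 2 ^ ?s'"
      using Suc.IH[of v w] Suc.IH[of v w'] w g by auto
    moreover have "(?b + 1) * 2 ^ ?s \<le> (?b + 1) * 2 ^ ?t" "(?b' + 1) * 2 ^ ?s' \<le> (?b' + 1) * 2 ^ ?t"
    proof -
      have ss: "?s \<le> ?t" "?s' \<le> ?t" using two(2) by linarith+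
      show "(?b + 1) * 2 ^ ?s \<le> (?b + 1) * 2 ^ ?t" by (rule mult_le_mono2, rule power_increasing[OF ss(1)]) simp
      show "(?b' + 1) * 2 ^ ?s' \<le> (?b' + 1) * 2 ^ ?t" by (rule mult_le_mono2, rule power_increasing[OF ss(2)]) simp
    qed
    ultimately have "2 ^ (Suc r + 1) \<le> (?b + ?b' + 2) * 2 ^ ?t" by (simp add: algebra_simps)
    also have "\<dots> \<le> (?B + 1) * 2 ^ ?t" using two(1) by (intro mult_le_mono) auto
    finally show ?thesis .
  qed
qed

lemma branch_disjoint_opposite:
  assumes "(u, v) \<in> E" "2 * r + 2 \<le> g"
  shows "branch E r u v \<inter> branch E r v u = {}"
proof (rule ccontr)
  assume "\<not> ?thesis"
  then obtain p where "near (del_edge u v E) r v p" "near (del_edge u v E) r u p"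
    by (auto simp: branch_def ball_def del_edge_commute)
  then have "near (del_edge u v E) (r + r) u v" 
    using near_trans[of "del_edge u v E" r u p r v] near_sym[OF sym_del_edge[OF symE], of u v r v p]
      near_sym[OF sym_del_edge[OF symE], of u v r u p] near_sym[OF sym_del_edge[OF symE], of u v r p v] by blast
  then show False using girth_geD[OF girth assms(1)] assms(2) by fastforce
qed

lemma card_ge_twice:
  assumes "(u, v) \<in> E" "2 * r + 2 \<le> g"
  shows "2 * r + 2 \<le> card V" "card (branch E r u v) + card (branch E r v u) \<le> card V"
    "card (branch E r u v \<inter> T) + card (branch E r v u \<inter> T) \<le> card T"
proof -
  have vu: "(v, u) \<in> E" using assms symE by (auto dest: symD)
  have fin: "finite (branch E r u v)" "finite (branch E r v u)" using finite_branch assms(1) vu by blast+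
  have d: "branch E r u v \<inter> branch E r v u = {}" using branch_disjoint_opposite[OF assms] .
  have "branch E r u v \<union> branch E r v u \<subseteq> V" using branch_subset assms(1) EV by auto
  then have "card (branch E r u v \<union> branch E r v u) \<le> card V" by (rule card_mono[OF finV])
  then show c: "card (branch E r u v) + card (branch E r v u) \<le> card V"
    using card_Un_disjoint[OF fin d] by simp
  show "2 * r + 2 \<le> card V"
    using c card_branch_ge[OF assms(1), of r] card_branch_ge[OF vu, of r] assms(2) by linarith
  have "card (branch E r u v \<inter> T) + card (branch E r v u \<inter> T) = card (branch E r u v \<inter> T \<union> branch E r v u \<inter> T)"
    by (rule card_Un_disjoint[symmetric]) (use fin d in auto)
  also have "\<dots> \<le> card T"
    by (rule card_mono) (use finV T(1) finite_subset in auto)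
  finally show "card (branch E r u v \<inter> T) + card (branch E r v u \<inter> T) \<le> card T" .
qed

text \<open>If every edge met \<open>T\<close>, there would be at most 4|T| arcs: the 2|T| arcs
  starting in \<open>T\<close> and their reverses. But the degrees sum to 3|V| - |T|.\<close>

lemma exists_cubic_arc:
  assumes "5 * card T < 3 * card V"
  shows "\<exists>u v. (u, v) \<in> E \<and> u \<notin> T \<and> v \<notin> T"
proof (rule ccontr)
  assume none: "\<not> ?thesis"
  have finT: "finite T" using T(1) finV finite_subset by blast
  have fE: "finite (E `` {v})" for v using EV finV by (meson finite_Image finite_SigmaI finite_subset)
  let ?A = "SIGMA u:T. E `` {u}"
  have cA: "card ?A = 2 * card T" using finT fE T(2) by (simp add: card_SigmaI)
  have finA: "finite ?A" using finT fE by auto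
  have "E \<subseteq> ?A \<union> ?A\<inverse>" using none symE by (auto dest: symD)
  then have "card E \<le> card (?A \<union> ?A\<inverse>)" using finA by (intro card_mono) auto
  also have "\<dots> \<le> 4 * card T" using card_Un_le[of ?A "?A\<inverse>"] cA by simp
  finally have le: "card E \<le> 4 * card T" .
  have "card E = (\<Sum>v\<in>V. card (E `` {v}))" by (rule card_eq_sum_degrees[OF finV EV])
  also have "\<dots> = (\<Sum>v\<in>V - T. card (E `` {v})) + (\<Sum>v\<in>T. card (E `` {v}))"
    by (rule sum.subset_diff[OF T(1) finV])
  also have "\<dots> = 3 * card (V - T) + 2 * card T" using T by simp
  also have "card (V - T) = card V - card T" using T(1) finT by (rule card_Diff_subset[rotated])
  finally show False using le assms card_mono[OF finV T(1)] by linarith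
qed

text \<open>Four disjoint branches of radius h - 2 hang at an edge whose ends both have degree 3.
  One that contains t vertices of \<open>T\<close> has at least 2^(h-1-t) - 1 vertices, and the four
  values of t sum to at most |T|. By convexity an even distribution is the worst; the secant through
  k and k + 1 turns this into a bound linear in |T|, with k free to be chosen near |T|/4.\<close>

lemma moore_bound_min_degree_two:
  assumes h: "2 * h \<le> g" "h \<ge> 2" and t: "card T \<le> h" and ne: "V \<noteq> {}"
  shows "2 * h \<le> card V"
    and "2 ^ (h - 1) / 2 ^ k * (4 + (4 * real k - card T) / 2) \<le> real (card V) + 2"
proof -
  obtain r where r: "h = Suc (Suc r)" using h(2) by (metis add_2_eq_Suc le_Suc_ex)
  obtain x where "x \<in> V" using ne by blast
  then have "card (E `` {x}) \<noteq> 0" using T(2)[of x] T(3)[of x] by (cases "x \<in> T") auto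
  then have "E `` {x} \<noteq> {}" by (metis card.empty)
  then obtain y where "(x, y) \<in> E" by blast
  from card_ge_twice(1)[OF this, of "Suc r"] show V: "2 * h \<le> card V" using h r by simp
  then have "5 * card T < 3 * card V" using t h by linarith
  then obtain u v where uv: "(u, v) \<in> E" "u \<notin> T" "v \<notin> T" using exists_cubic_arc by blast
  have vu: "(v, u) \<in> E" using uv symE by (auto dest: symD)
  have g: "2 * r + 3 \<le> g" "2 * Suc r + 2 \<le> g" "2 * r + 1 \<le> g" using h r by auto
  obtain a b where ab: "a \<noteq> b" "E `` {v} - {u} = {a, b}" using other_neighbours(2)[OF uv(1,3)] by blast
  obtain c d where cd: "c \<noteq> d" "E `` {u} - {v} = {c, d}" using other_neighbours(2)[OF vu uv(2)] by blast
  have arcs: "(v, a) \<in> E" "(v, b) \<in> E" "(u, c) \<in> E" "(u, d) \<in> E" using ab cd by auto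
  let ?b = "\<lambda>x y. real (card (branch E r x y))" and ?t = "\<lambda>x y. card (branch E r x y \<inter> T)"
  have conv: "2 ^ (h - 1) / 2 ^ k * (1 + (real k - real (?t x y)) / 2) \<le> ?b x y + 1" if "(x, y) \<in> E" for x y
  proof -
    \<comment> \<open>$2^{-t}$ lies above the secant of this convex function through $k$ and $k + 1$ at all integers $t$.\<close>
    have lin: "(1 + (real k - real t) / 2) * 2 ^ t \<le> 2 ^ k" for t
    proof (cases "t \<le> k")
      case True
      have "1 + real (k - t) / 2 \<le> 2 ^ (k - t)"
        using Bernoulli_inequality[of "1::real" "k - t"] by simp
      then have "(1 + real (k - t) / 2) * 2 ^ t \<le> 2 ^ (k - t) * 2 ^ t" by (rule mult_right_mono) simp
      then show ?thesis using True by (simp add: of_nat_diff flip: power_add)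
    next
      case False
      then obtain j where j: "t = Suc (k + j)" by (metis add_Suc_right less_imp_Suc_add not_le)
      have "(1 + (real k - real t) / 2) * 2 ^ t = ((1 - real j) / 2 * 2 * 2 ^ j) * 2 ^ k"
        unfolding j by (simp add: power_add field_simps)
      also have "\<dots> \<le> 1 * 2 ^ k"
        by (intro mult_right_mono) (cases j, auto simp: mult_nonpos_nonneg intro: order_trans[of _ 0])
      finally show ?thesis by simp
    qed
    have "2 ^ (r + 1) \<le> (card (branch E r x y) + 1) * 2 ^ ?t x y" by (rule card_branch_ge_power[OF that g(3)])
    then have "real (2 ^ (r + 1)) \<le> real ((card (branch E r x y) + 1) * 2 ^ ?t x y)" by (simp only: of_nat_le_iff)
    then have "2 ^ (h - 1) \<le> (?b x y + 1) * 2 ^ ?t x y" using r by (simp add: algebra_simps)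
    then have "2 ^ (h - 1) * (2 ^ k / 2 ^ ?t x y) / 2 ^ k \<le> ?b x y + 1" by (simp add: field_simps)
    moreover have "2 ^ (h - 1) * (1 + (real k - real (?t x y)) / 2) / 2 ^ k \<le> 2 ^ (h - 1) * (2 ^ k / 2 ^ ?t x y) / 2 ^ k"
      using lin[of "?t x y"] by (intro divide_right_mono mult_left_mono) (auto simp: pos_le_divide_eq)
    ultimately show ?thesis by simp
  qed
  have b2: "?b v a + ?b v b + 1 \<le> real (card (branch E (Suc r) u v))" "?b u c + ?b u d + 1 \<le> real (card (branch E (Suc r) v u))"
    using card_branch_two(1)[OF uv(1) g(1) ab(2,1)] card_branch_two(1)[OF vu g(1) cd(2,1)] by linarith+
  have bV: "real (card (branch E (Suc r) u v)) + real (card (branch E (Suc r) v u)) \<le> real (card V)"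
    using card_ge_twice(2)[OF uv(1) g(2)] by linarith
  have tt: "?t v a + ?t v b + ?t u c + ?t u d \<le> card T"
    using card_branch_two(2)[OF uv(1) g(1) ab(2,1)] card_branch_two(2)[OF vu g(1) cd(2,1)] card_ge_twice(3)[OF uv(1) g(2)] by linarith
  let ?P = "2 ^ (h - 1) / 2 ^ k :: real" and ?x = "\<lambda>x y. 1 + (real k - real (?t x y)) / 2"
  have "real (?t v a) + real (?t v b) + real (?t u c) + real (?t u d) \<le> real (card T)"
    using tt by linarith
  then have "4 + (4 * real k - real (card T)) / 2 \<le> ?x v a + ?x v b + ?x u c + ?x u d" by (simp add: field_simps)
  then have "?P * (4 + (4 * real k - card T) / 2) \<le> ?P * (?x v a + ?x v b + ?x u c + ?x u d)"
    by (rule mult_left_mono) simp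
  also have "\<dots> = ?P * ?x v a + ?P * ?x v b + ?P * ?x u c + ?P * ?x u d" by (simp only: distrib_left)
  also have "\<dots> \<le> (?b v a + 1) + (?b v b + 1) + (?b u c + 1) + (?b u d + 1)"
    by (intro add_mono conv arcs)
  finally show "2 ^ (h - 1) / 2 ^ k * (4 + (4 * real k - card T) / 2) \<le> real (card V) + 2"
    using b2 bV by linarith
qed

end


section \<open>Edge boundaries in cubic graphs, and passage to a core of minimum degree two\<close>

definition cubic_graph :: "'a set \<Rightarrow> 'a rel \<Rightarrow> bool" where
  "cubic_graph V E \<longleftrightarrow> finite V \<and> E \<subseteq> V \<times> V \<and> sym E \<and> irrefl E \<and> (\<forall>v\<in>V. card (E `` {v}) = 3)"

definition boundary :: "'a rel \<Rightarrow> 'a set \<Rightarrow> 'a rel" where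
  "boundary E X = {(u, v) \<in> E. u \<in> X \<and> v \<notin> X}"

lemma finite_arcs: "cubic_graph V E \<Longrightarrow> finite E"
  by (auto simp: cubic_graph_def intro: finite_subset[of E "V \<times> V"])

lemma card_boundary:
  assumes "cubic_graph V E" "X \<subseteq> V"
  shows "card (boundary E X) + card (E \<inter> X \<times> X) = 3 * card X"
proof -
  have fX: "finite X" using assms finite_subset by (auto simp: cubic_graph_def)
  have fE: "finite E" using assms(1) by (rule finite_arcs)
  have "(SIGMA u:X. E `` {u}) = boundary E X \<union> E \<inter> X \<times> X" by (auto simp: boundary_def)
  moreover have "card (boundary E X \<union> E \<inter> X \<times> X) = card (boundary E X) + card (E \<inter> X \<times> X)"
    by (rule card_Un_disjoint) (use fE in \<open>auto simp: boundary_def intro: finite_subset[of _ E]\<close>)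
  moreover have "card (SIGMA u:X. E `` {u}) = (\<Sum>u\<in>X. card (E `` {u}))"
    using fX fE by (simp add: card_SigmaI finite_Image)
  moreover have "(\<Sum>u\<in>X. card (E `` {u})) = (\<Sum>u\<in>X. 3)"
    by (rule sum.cong) (use assms in \<open>auto simp: cubic_graph_def\<close>)
  ultimately show ?thesis by simp
qed

lemma card_arcs_insert:
  assumes "finite E" "sym E" "irrefl E" "v \<notin> X"
  shows "card (E \<inter> insert v X \<times> insert v X) = card (E \<inter> X \<times> X) + 2 * card (E `` {v} \<inter> X)"
proof -
  let ?A = "{v} \<times> (E `` {v} \<inter> X)" and ?I = "E \<inter> X \<times> X"
  have eq: "E \<inter> insert v X \<times> insert v X = ?I \<union> (?A \<union> ?A\<inverse>)"
    using assms(2,3) by (auto simp: irrefl_def dest: symD)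
  have f: "finite ?A" "finite (?A\<inverse>)" "finite ?I" using assms(1) by (auto simp: finite_Image)
  have d: "?A \<inter> ?A\<inverse> = {}" "?I \<inter> (?A \<union> ?A\<inverse>) = {}" using assms(4) by auto
  have "card (E \<inter> insert v X \<times> insert v X) = card ?I + (card ?A + card (?A\<inverse>))"
    unfolding eq using f d by (simp add: card_Un_disjoint)
  then show ?thesis by (simp add: card_cartesian_product)
qed

lemma boundary_insert:
  assumes "cubic_graph V E" "X \<subseteq> V" "v \<in> V" "v \<notin> X"
  shows "card (boundary E (insert v X)) + 2 * card (E `` {v} \<inter> X) = card (boundary E X) + 3"
proof -
  have "finite X" "finite E" "sym E" "irrefl E"
    using assms finite_subset finite_arcs by (auto simp: cubic_graph_def)
  then show ?thesis
    using card_boundary[OF assms(1,2)] card_boundary[OF assms(1), of "insert v X"] card_arcs_insert[of E v X] assms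
    by simp
qed

text \<open>A vertex with d \<le> 1 neighbours inside is removed; the boundary changes by 2d - 3, so
  it drops by at least 1 and stays at most the size of the set. The process stops before the set is
  exhausted, because a single vertex has boundary 3.\<close>

lemma exists_core:
  assumes "cubic_graph V E"
  shows "X \<subseteq> V \<Longrightarrow> X \<noteq> {} \<Longrightarrow> card (boundary E X) \<le> card X \<Longrightarrow>
    \<exists>Y\<subseteq>X. Y \<noteq> {} \<and> card (boundary E Y) \<le> card (boundary E X) \<and> (\<forall>v\<in>Y. card (E `` {v} \<inter> Y) \<ge> 2)"
proof (induction "card X" arbitrary: X)
  case 0
  then show ?case using assms finite_subset by (fastforce simp: cubic_graph_def)
next
  case (Suc n)
  show ?case
  proof (cases "\<forall>v\<in>X. card (E `` {v} \<inter> X) \<ge> 2")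
    case False
    then obtain v where v: "v \<in> X" "card (E `` {v} \<inter> X) \<le> 1" by force
    have irr: "(v, v) \<notin> E" using assms by (auto simp: cubic_graph_def irrefl_def)
    then have "E `` {v} \<inter> (X - {v}) = E `` {v} \<inter> X" by auto
    moreover have "insert v (X - {v}) = X" using v by auto
    ultimately have b: "card (boundary E X) + 2 * card (E `` {v} \<inter> X) = card (boundary E (X - {v})) + 3"
      using boundary_insert[OF assms, of "X - {v}" v] v(1) Suc.prems(1) by auto
    have c: "n = card (X - {v})" using v(1) Suc.hyps(2) by simp
    have "n \<noteq> 0"
    proof
      assume "n = 0"
      then have "X - {v} = {}" using c Suc.hyps(2) by (metis card_0_eq card.infinite finite_Diff_insert finite.emptyI nat.simps(3) Diff_empty)
      then have "boundary E (X - {v}) = {}" by (auto simp: boundary_def)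
      moreover have "E `` {v} \<inter> X = {}" using \<open>X - {v} = {}\<close> irr by auto
      ultimately have "card (boundary E X) = 3" using b by simp
      then show False using Suc.prems(3) Suc.hyps(2) \<open>n = 0\<close> by simp
    qed
    then have ne: "X - {v} \<noteq> {}" using c by (metis card.empty)
    have sub: "X - {v} \<subseteq> V" using Suc.prems(1) by blast
    have le: "card (boundary E (X - {v})) \<le> card (X - {v})"
      using b v(2) Suc.prems(3) Suc.hyps(2) c by linarith
    obtain Y where "Y \<subseteq> X - {v}" "Y \<noteq> {}" "card (boundary E Y) \<le> card (boundary E (X - {v}))"
      "\<forall>v\<in>Y. card (E `` {v} \<inter> Y) \<ge> 2"
      using Suc.hyps(1)[OF c sub ne le] by blast
    then show ?thesis using b v(2) by (intro exI[of _ Y] conjI) (blast, blast, linarith, blast)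
  qed (use Suc.prems in blast)
qed

text \<open>Inside the core the degrees are 2 and 3, and each vertex of degree 2 sends exactly one
  arc out, so \<open>T\<close> is as large as the boundary of the core. The core has at most the
  size and the boundary of \<open>X\<close>, and the second bound decreases with the
  boundary.\<close>

theorem moore_bound:
  assumes cub: "cubic_graph V E" and girth: "girth_ge g E"
    and X: "X \<subseteq> V" "X \<noteq> {}" "card (boundary E X) \<le> card X"
    and h: "2 * h \<le> g" "h \<ge> 2" "card (boundary E X) \<le> h"
  shows "2 * h \<le> card X"
    and "2 ^ (h - 1) / 2 ^ k * (4 + (4 * real k - card (boundary E X)) / 2) \<le> real (card X) + 2"
proof -
  have E: "finite V" "E \<subseteq> V \<times> V" "sym E" "irrefl E" "\<And>v. v \<in> V \<Longrightarrow> card (E `` {v}) = 3"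
    using cub by (auto simp: cubic_graph_def)
  have fE: "finite E" using cub by (rule finite_arcs)
  obtain Y where Y: "Y \<subseteq> X" "Y \<noteq> {}" "card (boundary E Y) \<le> card (boundary E X)"
    "\<And>v. v \<in> Y \<Longrightarrow> card (E `` {v} \<inter> Y) \<ge> 2"
    using exists_core[OF cub X] by blast
  have fX: "finite X" using X(1) E(1) by (rule finite_subset)
  have fY: "finite Y" "Y \<subseteq> V" "finite X" using finite_subset[OF Y(1) fX] Y(1) X(1) fX by auto
  define F where "F = E \<inter> Y \<times> Y"
  define T where "T = {v \<in> Y. card (F `` {v}) = 2}"
  have img: "F `` {v} = E `` {v} \<inter> Y" if "v \<in> Y" for v using that by (auto simp: F_def)
  have d2: "card (F `` {v}) = 2" if "v \<in> T" for v using that by (simp add: T_def)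
  have d3: "card (F `` {v}) = 3" if "v \<in> Y - T" for v
  proof -
    have v: "v \<in> Y" "v \<in> V" "card (F `` {v}) \<noteq> 2" using that fY(2) by (auto simp: T_def)
    have "card (E `` {v} \<inter> Y) \<le> card (E `` {v})" using finite_Image[OF fE] by (rule card_mono) blast
    then show ?thesis using v(3) Y(4)[OF v(1)] img[OF v(1)] E(5)[OF v(2)] by simp
  qed
  have FY: "F \<subseteq> Y \<times> Y" by (auto simp: F_def)
  have TY: "T \<subseteq> Y" by (auto simp: T_def)
  have "card F = (\<Sum>v\<in>Y. card (F `` {v}))" by (rule card_eq_sum_degrees[OF fY(1) FY])
  also have "\<dots> = (\<Sum>v\<in>Y - T. card (F `` {v})) + (\<Sum>v\<in>T. card (F `` {v}))"
    by (rule sum.subset_diff[OF TY fY(1)])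
  also have "\<dots> = 3 * card (Y - T) + 2 * card T" using d2 d3 by simp
  finally have "card F = 3 * card (Y - T) + 2 * card T" .
  moreover have "card (Y - T) = card Y - card T" by (rule card_Diff_subset[OF finite_subset[OF TY fY(1)] TY])
  moreover have "card T \<le> card Y" by (rule card_mono[OF fY(1) TY])
  ultimately have T: "card T = card (boundary E Y)" using card_boundary[OF cub fY(2)] unfolding F_def by linarith
  have "girth_ge g F" using girth by (rule girth_ge_subset) (simp add: F_def)
  moreover have "sym F" "irrefl F" using E(3,4) by (auto simp: F_def sym_def irrefl_def)
  ultimately have prem: "girth_ge g F" "sym F" "irrefl F" "F \<subseteq> Y \<times> Y" "finite Y" "T \<subseteq> Y"
    "\<And>v. v \<in> T \<Longrightarrow> card (F `` {v}) = 2"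
    using FY fY(1) TY d2 by blast+
  have c: "card Y \<le> card X" using card_mono[OF fY(3) Y(1)] .
  have Th: "card T \<le> h" using T Y(3) h(3) by linarith
  show "2 * h \<le> card X"
    using moore_bound_min_degree_two(1)[OF prem d3 h(1,2) Th Y(2)] c by linarith
  have "2 ^ (h - 1) / 2 ^ k * (4 + (4 * real k - card (boundary E X)) / 2) \<le>
    2 ^ (h - 1) / 2 ^ k * (4 + (4 * real k - card T) / 2)"
    using T Y(3) by (intro mult_left_mono) auto
  also have "\<dots> \<le> real (card Y) + 2"
    by (rule moore_bound_min_degree_two(2)[OF prem d3 h(1,2) Th Y(2)])
  finally show "2 ^ (h - 1) / 2 ^ k * (4 + (4 * real k - card (boundary E X)) / 2) \<le> real (card X) + 2"
    using c by linarith
qed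

section \<open>Edge cuts in a graph containing the grid\<close>

lemma falling_step:
  fixes x z :: nat
  assumes "x < z" "P x" "\<not> P z"
  shows "\<exists>y. x \<le> y \<and> y < z \<and> P y \<and> \<not> P (Suc y)"
proof (rule ccontr)
  assume none: "\<not> ?thesis"
  have "P (x + k)" if "x + k \<le> z" for k
    using that
  proof (induction k)
    case (Suc k)
    then have "P (x + k)" "x + k < z" by auto
    then show ?case using none by (metis add_Suc_right le_add1)
  qed (use assms in simp)
  from this[of "z - x"] assms show False by simp
qed

lemma card_boundary_compl:
  assumes "sym E" "E \<subseteq> V \<times> V"
  shows "card (boundary E (V - X)) = card (boundary E (X \<inter> V))"
proof -
  have "boundary E (V - X) = (boundary E (X \<inter> V))\<inverse>"
    using assms by (auto simp: boundary_def dest: symD)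
  then show ?thesis by simp
qed

context
  fixes n L q N :: nat and E :: "nat rel"
  assumes cub: "cubic_graph {..<n} E"
    and path: "\<And>i. Suc i < n \<Longrightarrow> (i, Suc i) \<in> E"
    and wrap: "(n - 1, 0) \<in> E"
    and chord: "\<And>b. b + q < N \<Longrightarrow> (b * L + 1, (b + q) * L) \<in> E"
    and L: "2 \<le> L" and q: "0 < q" and N: "n \<le> N * L" "N * L < n + L" and large: "3 * q * L \<le> n"
begin

lemma symE: "sym E" using cub by (simp add: cubic_graph_def)

lemma N_large: "3 * q \<le> N"
proof -
  have "3 * q * L \<le> N * L" using large N(1) by linarith
  then show ?thesis using L by simp
qed

lemma block_less: "b < N \<Longrightarrow> b * L < n"
proof -
  assume "b < N"
  then have "(b + 1) * L \<le> N * L" by (intro mult_le_mono1) simp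
  then show ?thesis using N(2) by simp
qed

lemma n_ge_3: "3 \<le> n"
proof -
  have "3 * (1 * 1) \<le> 3 * (q * L)" using q L by (intro mult_le_mono) auto
  then show ?thesis using large by (simp only: mult.assoc)
qed

text \<open>The reserved vertices of the blocks $i, i + q, i + 2q, \ldots$, linked by chords and cycle arcs.\<close>
definition column :: "nat \<Rightarrow> nat set" where
  "column i = {b * L + 1 | b. b mod q = i \<and> b + q < N} \<union> {b * L | b. b mod q = i \<and> q \<le> b \<and> b < N}"

text \<open>The multiples \<open>b * L\<close> with b congruent to i modulo q recur with period
  \<open>q * L\<close>. Only the first block of the column receives no chord; there
  \<open>b * L + 1\<close> takes over.\<close>

lemma column_hits:
  assumes "i < q" "x + q * L \<le> n"
  shows "\<exists>y\<in>column i. x \<le> y \<and> y < x + q * L"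
proof -
  define M where "M = q * L"
  have M: "0 < M" using q L by (simp add: M_def)
  have iM: "i * L + L \<le> M"
    using mult_le_mono1[of "i + 1" q L] assms(1) by (simp add: M_def)
  \<comment> \<open>The first number from x on that is congruent to \<open>i * L\<close> modulo
    \<open>M\<close>; the multiple \<open>M * x\<close> keeps the natural subtraction from
    truncating.\<close>
  define w where "w = x + (i * L + M * x - x) mod M"
  have w: "x \<le> w" "w < x + M" using M by (auto simp: w_def)
  have xM: "x \<le> i * L + M * x" using M by (metis le_add2 le_trans mult_le_mono1 nat_mult_1 Suc_leI One_nat_def)
  have "w mod M = (x + (i * L + M * x - x)) mod M" by (simp add: w_def mod_add_right_eq)
  also have "\<dots> = i * L" using xM iM L by simp
  finally have "w mod M = i * L" .
  then have "w = w div M * M + i * L" by (metis div_mult_mod_eq)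
  then have wb: "w = (w div M * q + i) * L" by (simp add: M_def algebra_simps)
  define b where "b = w div M * q + i"
  have b: "w = b * L" "b mod q = i" using wb assms(1) by (auto simp: b_def)
  have "b * L < n" using b(1) w(2) assms(2) unfolding M_def by linarith
  then have "b * L < N * L" using N(1) by linarith
  then have bN: "b < N" using L by simp
  show ?thesis
  proof (cases "q \<le> b")
    case True
    then have "w \<in> column i" using b bN by (auto simp: column_def)
    then show ?thesis using w by (auto simp: M_def)
  next
    case False
    then have bi: "b = i" using b(2) by simp
    have "i * L + 1 \<in> column i" using assms(1) N_large by (auto simp: column_def)
    moreover have "x \<le> i * L + 1" using w(1) b(1) bi by simp
    moreover have "i * L + 1 < x + M" using iM L by linarith
    ultimately show ?thesis by (auto simp: M_def)
  qed
qed

text \<open>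
  An arc between two vertices of one column can only be charged to that column, so fewer than $q$ cut arcs
  miss some column completely.
\<close>
lemma exists_monochromatic_column:
  assumes "card (boundary E X) < q"
  shows "\<exists>i<q. (\<forall>v\<in>column i. v \<in> X) \<or> (\<forall>v\<in>column i. v \<notin> X)"
proof -
  let ?c = "\<lambda>e. fst e div L mod q"
  have finB: "finite (boundary E X)" using finite_arcs[OF cub] by (rule finite_subset[rotated]) (auto simp: boundary_def)
  have "\<not> {..<q} \<subseteq> ?c ` boundary E X"
  proof
    assume "{..<q} \<subseteq> ?c ` boundary E X"
    then have "card {..<q} \<le> card (?c ` boundary E X)" using finB by (intro card_mono) auto
    also have "\<dots> \<le> card (boundary E X)" using finB by (rule card_image_le)
    finally show False using assms by simp
  qed
  then obtain i where i: "i < q" "\<And>e. e \<in> boundary E X \<Longrightarrow> ?c e \<noteq> i" by blast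
  have same: "u \<in> X \<longleftrightarrow> v \<in> X" if "(u, v) \<in> E" "u div L mod q = i" "v div L mod q = i" for u v
    using i(2)[of "(u, v)"] i(2)[of "(v, u)"] that symE by (auto simp: boundary_def dest: symD)
  have dL: "(b * L + 1) div L = b" "(b * L) div L = b" for b using L by (auto intro!: div_nat_eqI)
  have *: "b mod q = i \<Longrightarrow> (b + q < N \<longrightarrow> (b * L + 1 \<in> X \<longleftrightarrow> i * L + 1 \<in> X)) \<and>
      (q \<le> b \<and> b < N \<longrightarrow> (b * L \<in> X \<longleftrightarrow> i * L + 1 \<in> X))" for b
  proof (induction b rule: less_induct)
    case (less b)
    show ?case
    proof (cases "q \<le> b")
      case False
      then have "b = i" using less.prems by simp
      then show ?thesis using False by simp
    next
      case True
      have r: "(b - q) mod q = i" using True less.prems by (simp add: le_mod_geq)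
      have lo: "b * L \<in> X \<longleftrightarrow> i * L + 1 \<in> X" if "b < N"
      proof -
        have "(b - q) * L + 1 \<in> X \<longleftrightarrow> i * L + 1 \<in> X"
          using less.IH[of "b - q"] True that r q by auto
        moreover have "((b - q) * L + 1, b * L) \<in> E" using chord[of "b - q"] True that by simp
        ultimately show ?thesis using same[of "(b - q) * L + 1" "b * L"] dL r less.prems by simp
      qed
      have hi: "b * L + 1 \<in> X \<longleftrightarrow> i * L + 1 \<in> X" if "b + q < N"
      proof -
        have "(b + 1) * L < n" using block_less[of "b + 1"] that q by simp
        then have "(b * L, Suc (b * L)) \<in> E" using L by (intro path) simp
        then show ?thesis using lo that same[of "b * L" "b * L + 1"] dL less.prems by simp
      qed
      show ?thesis using lo hi by blast
    qed
  qed
  have "v \<in> X \<longleftrightarrow> i * L + 1 \<in> X" if "v \<in> column i" for v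
    using that * by (auto simp: column_def)
  then show ?thesis using i(1) by blast
qed

definition ends :: "nat set \<Rightarrow> nat set" where
  "ends X = {y \<in> X. Suc y mod n \<notin> X}"

text \<open>A run of \<open>X\<close> is recorded by the vertex just before it, so that starts and
  ends are both tails of cycle arcs crossing the border of \<open>X\<close>.\<close>

definition starts :: "nat set \<Rightarrow> nat set" where
  "starts X = {y. y < n \<and> y \<notin> X \<and> Suc y mod n \<in> X}"

lemma cycle_arc: "y < n \<Longrightarrow> (y, Suc y mod n) \<in> E"
  using path[of y] wrap by (cases "Suc y < n") (auto simp: not_less_eq less_Suc_eq)

text \<open>The cyclic successor maps \<open>P\<close> bijectively onto \<open>X\<close>. Sets of
  equal size have differences of equal size, and these are the starts and the ends.\<close>

lemma card_starts: "X \<subseteq> {..<n} \<Longrightarrow> card (starts X) = card (ends X)"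
proof -
  assume X: "X \<subseteq> {..<n}"
  let ?s = "\<lambda>y. Suc y mod n"
  define P where "P = {y. y < n \<and> ?s y \<in> X}"
  have inj: "inj_on ?s {..<n}"
    by (rule inj_onI) (auto simp: mod_Suc split: if_splits)
  have "?s ` P = X"
  proof
    show "X \<subseteq> ?s ` P"
    proof
      fix x assume "x \<in> X"
      then have x: "x < n" using X by auto
      let ?y = "if x = 0 then n - 1 else x - 1"
      have "?s ?y = x" "?y < n" using x by auto
      then have "?y \<in> P" "x = ?s ?y" using \<open>x \<in> X\<close> unfolding P_def by auto
      then show "x \<in> ?s ` P" by (rule rev_image_eqI)
    qed
  qed (auto simp: P_def)
  moreover have "inj_on ?s P" using inj by (rule inj_on_subset) (auto simp: P_def)
  ultimately have cP: "card P = card X" using card_image by metis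
  have fin: "finite P" "finite X" using X finite_subset by (auto simp: P_def)
  have "starts X = P - X" "ends X = X - P" using X by (auto simp: starts_def ends_def P_def)
  moreover have "card (P - X) = card P - card (P \<inter> X)" "card (X - P) = card X - card (X \<inter> P)"
    using fin by (auto intro: card_Diff_subset_Int)
  ultimately show ?thesis using cP by (simp add: Int_commute)
qed

text \<open>Each maximal run of \<open>X\<close> on the Hamiltonian cycle is left by a cycle arc at
  either side. As the cycle has at least three vertices, all these arcs are distinct.\<close>

lemma twice_card_ends:
  assumes X: "X \<subseteq> {..<n}"
  shows "2 * card (ends X) \<le> card (boundary E X)"
proof -
  have fin: "finite (boundary E X)" using finite_arcs[OF cub] by (rule finite_subset[rotated]) (auto simp: boundary_def)
  let ?s = "\<lambda>y. Suc y mod n"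
  let ?A = "(\<lambda>y. (y, ?s y)) ` ends X" and ?B = "(\<lambda>y. (?s y, y)) ` starts X"
  have fe: "finite (ends X)" "finite (starts X)" using X finite_subset[of X "{..<n}"] by (auto simp: ends_def starts_def)
  have ne: "?s (?s y) \<noteq> y" if "y < n" for y using that n_ge_3 by (auto simp: mod_Suc split: if_splits)
  have "?A \<union> ?B \<subseteq> boundary E X"
    using X cycle_arc symE by (auto simp: boundary_def ends_def starts_def dest: symD)
  then have "card (?A \<union> ?B) \<le> card (boundary E X)" by (rule card_mono[OF fin])
  moreover have "?A \<inter> ?B = {}" using X ne by (auto simp: ends_def starts_def)
  then have "card (?A \<union> ?B) = card ?A + card ?B" using fe by (intro card_Un_disjoint) auto
  moreover have "card ?A = card (ends X)" "card ?B = card (starts X)"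
    by (auto intro!: card_image inj_onI)
  ultimately show ?thesis using card_starts[OF X] by linarith
qed

lemma ends_nonempty:
  assumes "X \<subseteq> {..<n}" "X \<noteq> {}" "X \<noteq> {..<n}"
  shows "card (ends X) \<ge> 1"
proof (rule ccontr)
  assume "\<not> ?thesis"
  moreover have "finite (ends X)" using assms(1) finite_subset[of X "{..<n}"] by (auto simp: ends_def)
  ultimately have "ends X = {}" by (simp add: not_le)
  then have step: "Suc y mod n \<in> X" if "y \<in> X" for y using that by (auto simp: ends_def)
  obtain x where x: "x \<in> X" using assms(2) by blast
  have all: "(x + k) mod n \<in> X" for k
  proof (induction k)
    case 0
    then show ?case using x assms(1) by auto
  next
    case (Suc k)
    then show ?case using step[OF Suc] by (simp add: mod_Suc_eq)
  qed
  have "y \<in> X" if "y < n" for y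
  proof -
    have "x < n" using x assms(1) by auto
    then have "(x + (y + n - x)) mod n = y" using that by simp
    then show ?thesis using all[of "y + n - x"] by simp
  qed
  then show False using assms(1,3) by auto
qed

text \<open>A run of \<open>X\<close> avoids the column, so it fits into a window of length
  \<open>q * L\<close> that finishes with the run. The windows of \<open>column_hits\<close> do not
  pass from n - 1 to 0; a run across that place is cut there, which accounts for the additional
  1.\<close>

lemma card_le_runs:
  assumes X: "X \<subseteq> {..<n}" and i: "i < q" "\<forall>v\<in>column i. v \<notin> X"
  shows "card X \<le> (card (ends X) + 1) * (q * L)"
proof -
  let ?Y = "insert (n - 1) (ends X)"
  have fe: "finite (ends X)" using X finite_subset[of X "{..<n}"] by (auto simp: ends_def)
  have "X \<subseteq> (\<Union>y\<in>?Y. {y + 1 - q * L..<y + 1})"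
  proof
    fix x assume x: "x \<in> X"
    have xn: "x < n" using x X by auto
    define y where "y = (LEAST y. x \<le> y \<and> (y = n - 1 \<or> Suc y \<notin> X))"
    have y: "x \<le> y" "y = n - 1 \<or> Suc y \<notin> X"
      using LeastI[of "\<lambda>y. x \<le> y \<and> (y = n - 1 \<or> Suc y \<notin> X)" "n - 1"] xn unfolding y_def by auto
    have le: "y \<le> n - 1" unfolding y_def by (rule Least_le) (use xn in auto)
    have run: "x + k \<in> X" if "x + k \<le> y" for k
      using that
    proof (induction k)
      case (Suc k)
      then have "\<not> (x \<le> x + k \<and> (x + k = n - 1 \<or> Suc (x + k) \<notin> X))"
        unfolding y_def by (intro not_less_Least) simp
      then show ?case by simp
    qed (use x in simp)
    have "y < x + q * L"
    proof (rule ccontr)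
      assume far: "\<not> y < x + q * L"
      then have "x + q * L \<le> n" using le xn by linarith
      then obtain z where z: "z \<in> column i" "x \<le> z" "z < x + q * L" using column_hits[OF i(1), of x] by blast
      then have "z \<in> X" using run[of "z - x"] far by simp
      then show False using z i(2) by blast
    qed
    moreover have "y \<in> ?Y"
    proof (cases "y = n - 1")
      case False
      then have "Suc y < n" "Suc y \<notin> X" "y \<in> X" using y le run[of "y - x"] by auto
      then show ?thesis by (simp add: ends_def)
    qed simp
    ultimately show "x \<in> (\<Union>y\<in>?Y. {y + 1 - q * L..<y + 1})" using y(1) by (intro UN_I[of y]) auto
  qed
  then have "card X \<le> card (\<Union>y\<in>?Y. {y + 1 - q * L..<y + 1})" using fe by (intro card_mono) auto
  also have "\<dots> \<le> (\<Sum>y\<in>?Y. card {y + 1 - q * L..<y + 1})" using fe by (intro card_UN_le) auto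
  also have "\<dots> \<le> (\<Sum>y\<in>?Y. q * L)" by (intro sum_mono) simp
  also have "\<dots> = card ?Y * (q * L)" by simp
  also have "\<dots> \<le> (card (ends X) + 1) * (q * L)" using card_insert_le_m1[of "card (ends X) + 1" "ends X" "n - 1"] by (intro mult_le_mono1) simp
  finally show ?thesis .
qed

text \<open>The ends u and d of a chord delimit a full window, so a column vertex, which is outside
  \<open>X\<close>, lies strictly between them. Another one lies on the rest of the cycle, beyond d
  or before u. Together they would break \<open>X\<close> into two runs.\<close>

lemma chord_not_inside:
  assumes X: "X \<subseteq> {..<n}" and i: "i < q" "\<forall>v\<in>column i. v \<notin> X" and one: "card (ends X) \<le> 1"
    and b: "b + q < N" "b * L + 1 \<in> X" "(b + q) * L \<in> X"
  shows False
proof -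
  define u where "u = b * L + 1"
  define d where "d = (b + q) * L"
  have uX: "u \<in> X" and dX: "d \<in> X" using b by (auto simp: u_def d_def)
  have ud: "u + q * L = d + 1" by (simp add: u_def d_def algebra_simps)
  have dn: "d < n" using X dX by auto
  have fe: "finite (ends X)" "finite (starts X)" using X finite_subset[of X "{..<n}"] by (auto simp: ends_def starts_def)
  have fall: "\<exists>y\<in>ends X. x \<le> y \<and> y < z" if xz: "x < z" "x \<in> X" "z \<notin> X" "z < n" for x z
  proof -
    obtain y where y: "x \<le> y" "y < z" "y \<in> X" "Suc y \<notin> X" using falling_step[of x z "\<lambda>v. v \<in> X"] xz by blast
    have "Suc y < n" using y(2) xz(4) by simp
    then have "y \<in> ends X" using y by (simp add: ends_def)
    then show ?thesis using y by blast
  qed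
  have rise: "\<exists>y\<in>starts X. x \<le> y \<and> y < z" if xz: "x < z" "x \<notin> X" "z \<in> X" "z < n" for x z
  proof -
    obtain y where y: "x \<le> y" "y < z" "y \<notin> X" "Suc y \<in> X" using falling_step[of x z "\<lambda>v. v \<notin> X"] xz by blast
    have "Suc y < n" using y(2) xz(4) by simp
    then have "y \<in> starts X" using y by (simp add: starts_def)
    then show ?thesis using y by blast
  qed
  have two: False if "y \<in> S" "y' \<in> S" "y < y'" "finite S" "card S \<le> 1" for y y' :: nat and S
  proof -
    have "card {y, y'} \<le> card S" by (rule card_mono) (use that in auto)
    then show False using that(3,5) by simp
  qed
  obtain w where w: "w \<in> column i" "u \<le> w" "w < u + q * L" using column_hits[OF i(1), of u] ud dn by auto
  have wX: "w \<notin> X" using w(1) i(2) by blast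
  have "w \<noteq> u" "w \<noteq> d" using wX uX dX by auto
  then have uw: "u < w" "w < d" using w ud by linarith+
  show False
  proof (cases "d + 1 + q * L \<le> n")
    case True
    then obtain w2 where w2: "w2 \<in> column i" "d + 1 \<le> w2" "w2 < d + 1 + q * L" using column_hits[OF i(1), of "d + 1"] by auto
    obtain y where y: "y \<in> ends X" "u \<le> y" "y < w" using fall[of u w] uw uX wX dn by auto
    obtain y2 where y2: "y2 \<in> ends X" "d \<le> y2" using fall[of d w2] w2 dX i(2) True by auto
    show False using two[OF y(1) y2(1) _ fe(1) one] y y2 uw by simp
  next
    case False
    \<comment> \<open>Here d is within \<open>q * L\<close> of the end of the path, and 3qL \<le> n
      leaves a whole window before u.\<close>
    have qn: "q * L \<le> n" "q * L \<le> u" using large False ud by auto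
    then obtain w1 where w1: "w1 \<in> column i" "w1 < q * L" using column_hits[OF i(1), of 0] by auto
    obtain y where y: "y \<in> starts X" "y < u" using rise[of w1 u] w1 uX i(2) qn uw dn by auto
    obtain y2 where y2: "y2 \<in> starts X" "w \<le> y2" using rise[of w d] uw wX dX dn by auto
    show False using two[OF y(1) y2(1) _ fe(2)] y y2 uw one card_starts[OF X] by simp
  qed
qed

text \<open>
  When $X$ is a single arc of the Hamiltonian cycle, every block meeting $X$ contains the tail of an arc
  leaving $X$: a cycle arc if the block is only partly in $X$, and its chord otherwise.
\<close>
lemma card_le_blocks:
  assumes X: "X \<subseteq> {..<n}" and i: "i < q" "\<forall>v\<in>column i. v \<notin> X" and one: "card (ends X) \<le> 1"
  shows "card X \<le> card (boundary E X) * L"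
proof -
  have dL: "(b * L + 1) div L = b" "(b * L) div L = b" for b using L by (auto intro!: div_nat_eqI)
  have fin: "finite (boundary E X)" using finite_arcs[OF cub] by (rule finite_subset[rotated]) (auto simp: boundary_def)
  have tail: "\<exists>e\<in>boundary E X. fst e div L = x div L" if x: "x \<in> X" for x
  proof (cases "\<exists>z<n. z div L = x div L \<and> z \<notin> X")
    case True
    then obtain z where z: "z < n" "z div L = x div L" "z \<notin> X" by blast
    have xn: "x < n" using x X by auto
    have mid: "y div L = x div L" if "min x z \<le> y" "y \<le> max x z" for y
      using div_le_mono[OF that(1), of L] div_le_mono[OF that(2), of L] z(2) by (auto simp: min_def max_def split: if_splits)
    have "x \<noteq> z" using x z(3) by auto
    then consider "x < z" | "z < x" by linarith
    then show ?thesis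
    proof cases
      case 1
      then obtain y where y: "x \<le> y" "y < z" "y \<in> X" "Suc y \<notin> X" using falling_step[of x z "\<lambda>v. v \<in> X"] x z by auto
      then have "(y, Suc y) \<in> boundary E X" using path[of y] z(1) by (auto simp: boundary_def)
      then show ?thesis using mid[of y] y 1 by force
    next
      case 2
      then obtain y where y: "z \<le> y" "y < x" "y \<notin> X" "Suc y \<in> X" using falling_step[of z x "\<lambda>v. v \<notin> X"] x z by auto
      then have "(Suc y, y) \<in> boundary E X" using path[of y] xn symE by (auto simp: boundary_def dest: symD)
      then show ?thesis using mid[of "Suc y"] y 2 by force
    qed
  next
    case False
    define b where "b = x div L"
    have full: "z \<in> X" if "z < n" "z div L = b" for z using False that by (auto simp: b_def)
    have xn: "x < n" using x X by auto
    have "b * L \<le> x" by (simp add: b_def)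
    then have "b * L < N * L" using xn N(1) by linarith
    then have bN: "b < N" using L by simp
    show ?thesis
    proof (cases "b + q < N")
      case True
      have "(b + 1) * L < n" using block_less[of "b + 1"] True q by simp
      then have "b * L + 1 \<in> X" using full[OF _ dL(1)[of b]] L by simp
      moreover from this have "(b + q) * L \<notin> X" using chord_not_inside[OF X i one True] by blast
      ultimately have "(b * L + 1, (b + q) * L) \<in> boundary E X" using chord[OF True] by (simp add: boundary_def)
      then show ?thesis using dL(1)[of b] unfolding b_def[symmetric] by force
    next
      case no: False
      \<comment> \<open>The last q blocks emit no chord; the one arriving at their first vertex
        serves instead.\<close>
      have qb: "q \<le> b" using no N_large by linarith
      have "b * L \<in> X" using block_less[OF bN] by (intro full) (auto simp: dL)
      moreover from this have "(b - q) * L + 1 \<notin> X" using chord_not_inside[OF X i one, of "b - q"] qb bN by auto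
      moreover have "(b * L, (b - q) * L + 1) \<in> E" using chord[of "b - q"] qb bN symE by (auto dest: symD)
      ultimately have "(b * L, (b - q) * L + 1) \<in> boundary E X" by (simp add: boundary_def)
      then show ?thesis using dL(2)[of b] unfolding b_def[symmetric] by force
    qed
  qed
  have "X \<subseteq> (\<Union>e\<in>boundary E X. {fst e div L * L..<fst e div L * L + L})"
  proof
    fix x assume "x \<in> X"
    then obtain e where e: "e \<in> boundary E X" "fst e div L = x div L" using tail by blast
    have "x \<in> {x div L * L..<x div L * L + L}" using L dividend_less_div_times[of L x] by (auto simp: add.commute)
    then show "x \<in> (\<Union>e\<in>boundary E X. {fst e div L * L..<fst e div L * L + L})" using e by (intro UN_I[of e]) auto
  qed
  then have "card X \<le> card (\<Union>e\<in>boundary E X. {fst e div L * L..<fst e div L * L + L})" using fin by (intro card_mono) auto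
  also have "\<dots> \<le> (\<Sum>e\<in>boundary E X. card {fst e div L * L..<fst e div L * L + L})" using fin by (rule card_UN_le)
  also have "\<dots> = card (boundary E X) * L" by simp
  finally show ?thesis .
qed

text \<open>With fewer than q cut arcs some column is uncut, and the side that avoids it is the
  small one. It has at most a/2 runs for a cut arcs, hence a single run if a \<le> 3, where counting
  blocks is better than counting windows.\<close>

theorem isoperimetry:
  assumes A: "A \<subseteq> {..<n}" "A \<noteq> {}" "A \<noteq> {..<n}" and a: "card (boundary E A) < q"
  shows "2 \<le> card (boundary E A)"
    and "\<exists>X. (X = A \<or> X = {..<n} - A) \<and> card X \<le> (card (boundary E A) div 2 + 1) * (q * L) \<and>
      (card (boundary E A) \<le> 3 \<longrightarrow> card X \<le> card (boundary E A) * L)"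
proof -
  show "2 \<le> card (boundary E A)" using twice_card_ends[OF A(1)] ends_nonempty[OF A] by linarith
  obtain i where i: "i < q" "(\<forall>v\<in>column i. v \<in> A) \<or> (\<forall>v\<in>column i. v \<notin> A)"
    using exists_monochromatic_column[OF a] by blast
  define X where "X = (if \<forall>v\<in>column i. v \<notin> A then A else {..<n} - A)"
  have X: "X \<subseteq> {..<n}" "\<forall>v\<in>column i. v \<notin> X" using A(1) i(2) by (auto simp: X_def)
  have bX: "card (boundary E X) = card (boundary E A)"
    using card_boundary_compl[OF symE, of "{..<n}" A] cub A(1) by (auto simp: X_def cubic_graph_def Int_absorb2)
  have e: "2 * card (ends X) \<le> card (boundary E A)" using twice_card_ends[OF X(1)] bX by simp
  then have "(card (ends X) + 1) * (q * L) \<le> (card (boundary E A) div 2 + 1) * (q * L)"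
    by (intro mult_le_mono1) linarith
  then have "card X \<le> (card (boundary E A) div 2 + 1) * (q * L)"
    using card_le_runs[OF X(1) i(1) X(2)] by linarith
  moreover have "card X \<le> card (boundary E A) * L" if "card (boundary E A) \<le> 3"
    using card_le_blocks[OF X(1) i(1) X(2)] e that bX by simp
  ultimately show "\<exists>X. (X = A \<or> X = {..<n} - A) \<and> card X \<le> (card (boundary E A) div 2 + 1) * (q * L) \<and>
      (card (boundary E A) \<le> 3 \<longrightarrow> card X \<le> card (boundary E A) * L)"
    by (intro exI[of _ X]) (auto simp: X_def)
qed

end

section \<open>The skeleton\<close>

definition path_arcs :: "nat \<Rightarrow> nat rel" where
  "path_arcs n = {(i, j). i < n \<and> j < n \<and> (j = Suc i \<or> i = Suc j)}"

text \<open>Each block receives a chord at its first vertex and emits one from its second; this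
  offset keeps all chord ends distinct.\<close>

definition chord_arcs :: "nat \<Rightarrow> nat \<Rightarrow> nat \<Rightarrow> nat rel" where
  "chord_arcs L q k = {(b * L + 1, (b + q) * L) | b. b < k}"

text \<open>The number \<open>k\<close> of chords is a parameter so that they can be inserted one at
  a time from the left.\<close>

definition grid :: "nat \<Rightarrow> nat \<Rightarrow> nat \<Rightarrow> nat \<Rightarrow> nat rel" where
  "grid n L q k = path_arcs n \<union> chord_arcs L q k \<union> (chord_arcs L q k)\<inverse>"

text \<open>The arc that closes the Hamiltonian cycle comes last, so that the potentials for the
  chords only have to live on a path.\<close>

definition skeleton :: "nat \<Rightarrow> nat \<Rightarrow> nat \<Rightarrow> nat \<Rightarrow> nat \<Rightarrow> nat \<Rightarrow> nat rel" where
  "skeleton n L q N s t = add_edge 0 (n - 1) (add_edge s t (grid n L q (N - q)))"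

definition circ_dist :: "nat \<Rightarrow> nat \<Rightarrow> int" where
  "circ_dist D z = int (min (z mod D) (D - z mod D))"

lemma circ_dist_add [simp]: "circ_dist D (z + D) = circ_dist D z"
  by (simp add: circ_dist_def)

lemma circ_dist_Suc: "0 < D \<Longrightarrow> \<bar>circ_dist D (Suc z) - circ_dist D z\<bar> \<le> 1"
  using mod_less_divisor[of D z] by (auto simp: circ_dist_def mod_Suc)

lemma circ_dist_less: "z < D \<Longrightarrow> circ_dist D z = int (min z (D - z))"
  by (simp add: circ_dist_def)

lemma sym_grid: "sym (grid n L q k)"
  by (auto simp: sym_def grid_def path_arcs_def)

lemma not_near_lipschitz:
  fixes f :: "'a \<Rightarrow> int"
  assumes "\<And>u v. (u, v) \<in> E \<Longrightarrow> \<bar>f v - f u\<bar> \<le> 1" "f x + int k < f y \<or> f y + int k < f x"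
  shows "\<not> near E k x y"
proof
  assume nr: "near E k x y"
  have "f y \<le> f x + int k"
    using near_lipschitz[of E f k x y] assms(1) nr by force
  moreover have "- f y \<le> - f x + int k"
    using near_lipschitz[of E "\<lambda>v. - f v" k x y] assms(1) nr by force
  ultimately show False using assms(2) by linarith
qed

lemma grid_lipschitz:
  fixes f :: "nat \<Rightarrow> int"
  assumes "\<And>i. Suc i < n \<Longrightarrow> \<bar>f (Suc i) - f i\<bar> \<le> 1" "\<And>b. b < k \<Longrightarrow> \<bar>f ((b + q) * L) - f (b * L + 1)\<bar> \<le> 1"
    and "(u, v) \<in> grid n L q k"
  shows "\<bar>f v - f u\<bar> \<le> 1"
proof -
  consider "v = Suc u" "v < n" | "u = Suc v" "u < n" | b where "b < k" "u = b * L + 1" "v = (b + q) * L"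
    | b where "b < k" "v = b * L + 1" "u = (b + q) * L"
    using assms(3) by (auto simp: grid_def path_arcs_def chord_arcs_def)
  then show ?thesis
  proof cases
    case 1
    then show ?thesis using assms(1)[of u] by simp
  next
    case 2
    then show ?thesis using assms(1)[of v] by (simp add: abs_minus_commute)
  next
    case 3
    then show ?thesis using assms(2) by simp
  next
    case 4
    then show ?thesis using assms(2)[of b] by (simp add: abs_minus_commute)
  qed
qed

text \<open>Deleting an edge disconnects the path, so a potential may jump by g at the gap.\<close>

lemma girth_ge_path: "g \<ge> 2 \<Longrightarrow> girth_ge g (path_arcs n)"
  unfolding girth_ge_def
proof (safe)
  fix u v assume g: "g \<ge> 2" and uv: "(u, v) \<in> path_arcs n" and nr: "near (del_edge u v (path_arcs n)) (g - 2) u v"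
  define f :: "nat \<Rightarrow> int" where "f w = (if w \<le> min u v then 0 else int g)" for w
  have lip: "\<bar>f y - f x\<bar> \<le> 1" if "(x, y) \<in> del_edge u v (path_arcs n)" for x y
    using that uv by (auto simp: f_def del_edge_def path_arcs_def)
  have "f u + int (g - 2) < f v \<or> f v + int (g - 2) < f u"
    using uv g by (auto simp: f_def path_arcs_def)
  with nr show False using not_near_lipschitz[of "del_edge u v (path_arcs n)" f, OF lip] by simp
qed

context
  fixes g n L q N s t :: nat
  assumes g: "5 \<le> g" and Lg: "g \<le> 2 * L" "2 * L \<le> g + 1" and q: "4 \<le> q"
    and N: "n \<le> N * L" "N * L < n + L" and large: "g * q * L \<le> n"
    and st: "s = 2 * (2 * L - g)" "t = s + g - 1"
begin

lemma L3: "3 \<le> L" using g Lg by linarith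

lemma qL: "4 * L \<le> q * L" using q by (rule mult_le_mono1)

lemma grid_Suc: "grid n L q (Suc k) = add_edge (k * L + 1) ((k + q) * L) (grid n L q k)"
  by (auto simp: grid_def chord_arcs_def add_edge_def less_Suc_eq)

text \<open>
  The chords have length $D = qL - 1$, so the circular distance modulo $D$ is invariant under them. This
  gives a potential that changes by at most 1 along each arc and equals $2L \ge g$ and $0$ at the
  ends of the next chord.
\<close>
lemma far_chord:
  assumes "k + q < N"
  shows "\<not> near (grid n L q k) (g - 2) (k * L + 1) ((k + q) * L)"
proof -
  define D where "D = q * L - 1"
  define y where "y = (k + q) * L"
  have D: "0 < D" "2 * L \<le> D" "D + 1 = q * L" unfolding D_def using qL L3 by linarith+
  have Ly: "y = k * L + q * L" by (simp add: y_def algebra_simps)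
  \<comment> \<open>All chords inserted so far end at \<open>y - L\<close> or earlier. The linear
    slope over the last L vertices before y therefore meets no chord, and it adds L to the circular
    distance.\<close>
  define f :: "nat \<Rightarrow> int" where
    "f v = (if y \<le> v then 0 else if y \<le> v + L then int (y - v) else int L + circ_dist D (y - L - v))" for v
  have f_low: "f v = int L + circ_dist D (y - L - v)" if "v + L \<le> y" for v
    using that L3 by (auto simp: f_def circ_dist_def)
  have step: "\<bar>f (Suc i) - f i\<bar> \<le> 1" for i
  proof (cases "Suc i + L \<le> y")
    case True
    then have "Suc (y - L - Suc i) = y - L - i" by simp
    then show ?thesis using f_low[of i] f_low[of "Suc i"] True circ_dist_Suc[OF D(1), of "y - L - Suc i"]
      by (simp add: abs_minus_commute)
  next
    case False
    then show ?thesis by (auto simp: f_def)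
  qed
  have chord: "\<bar>f ((b + q) * L) - f (b * L + 1)\<bar> \<le> 1" if "b < k" for b
  proof -
    have "(b + 1) * L \<le> k * L" using that by (intro mult_le_mono1) simp
    then have bk: "b * L + L \<le> k * L" by simp
    have e: "(b + q) * L = b * L + 1 + D" using D(3) by (simp add: algebra_simps)
    have e': "(b + q) * L = b * L + q * L" by (simp add: algebra_simps)
    have le: "(b + q) * L + L \<le> y" "b * L + 1 + L \<le> y" using bk Ly qL L3 unfolding e' by linarith+
    have "y - L - (b * L + 1) = y - L - (b + q) * L + D" using le e by linarith
    then show ?thesis using f_low[OF le(1)] f_low[OF le(2)] by simp
  qed
  have "k * L + 1 + L \<le> y" using Ly qL L3 by linarith
  then have "f (k * L + 1) = int L + circ_dist D (y - L - (k * L + 1))" by (rule f_low)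
  also have "y - L - (k * L + 1) = D - L" using Ly D by linarith
  also have "circ_dist D (D - L) = int L" using D(2) L3 by (subst circ_dist_less) auto
  finally have "f (k * L + 1) = 2 * int L" by simp
  moreover have "f y = 0" by (simp add: f_def)
  ultimately have "f y + int (g - 2) < f (k * L + 1)" using Lg g by linarith
  then have "\<not> near (grid n L q k) (g - 2) (k * L + 1) y"
    by (intro not_near_lipschitz[of _ f] grid_lipschitz[of n f k q L, OF step chord] disjI2)
  then show ?thesis by (simp add: y_def)
qed

lemma girth_ge_grid: "k + q \<le> N \<Longrightarrow> girth_ge g (grid n L q k)"
proof (induction k)
  case 0
  have "grid n L q 0 = path_arcs n" by (simp add: grid_def chord_arcs_def)
  then show ?case using girth_ge_path g by simp
next
  case (Suc k)
  then show ?case unfolding grid_Suc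
    by (intro girth_ge_add_edge sym_grid far_chord) auto
qed

text \<open>The circular distance from s modulo the chord length D is constant along chords, and it
  equals g - 1 at t because 2(g - 1) \<le> D. Adding \<open>D - s\<close> replaces the subtraction
  of s.\<close>

lemma far_special: "\<not> near (grid n L q k) (g - 2) s t"
proof -
  define D where "D = q * L - 1"
  have D: "0 < D" "2 * (g - 1) \<le> D" "D + 1 = q * L" "s \<le> D" unfolding D_def using qL L3 Lg g st(1) by linarith+
  define f :: "nat \<Rightarrow> int" where "f v = circ_dist D (v + (D - s))" for v
  have step: "\<bar>f (Suc i) - f i\<bar> \<le> 1" for i
    using circ_dist_Suc[OF D(1), of "i + (D - s)"] by (simp add: f_def)
  have chord: "\<bar>f ((b + q) * L) - f (b * L + 1)\<bar> \<le> 1" for b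
  proof -
    have "(b + q) * L + (D - s) = b * L + 1 + (D - s) + D" using D(3) by (simp add: algebra_simps)
    then have "f ((b + q) * L) = f (b * L + 1)" unfolding f_def by (simp only: circ_dist_add)
    then show ?thesis by simp
  qed
  have "f s = 0" using D by (simp add: f_def circ_dist_def)
  moreover have "t + (D - s) = (g - 1) + D" using st g D(4) by simp
  then have "f t = circ_dist D (g - 1)" by (simp add: f_def)
  then have "f t = int (g - 1)" using D(2) g by (subst (asm) circ_dist_less) auto
  ultimately have "f s + int (g - 2) < f t" using g by simp
  then show ?thesis
    by (intro not_near_lipschitz[of _ f] grid_lipschitz[of n f k q L, OF step chord] disjI1)
qed

text \<open>No arc advances by more than D = qL - 1 vertices, so \<open>v div D\<close> changes by
  at most 1. The assumption gqL \<le> n is what makes it reach g - 1 at the far end.\<close>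

lemma far_wrap: "\<not> near (add_edge s t (grid n L q k)) (g - 2) 0 (n - 1)"
proof -
  define D where "D = q * L - 1"
  have D: "0 < D" "2 * (g - 1) \<le> D" "D + 1 = q * L" "s \<le> D" unfolding D_def using qL L3 Lg g st(1) by linarith+
  define f :: "nat \<Rightarrow> int" where "f v = int (v div D)" for v
  have step: "\<bar>f (Suc i) - f i\<bar> \<le> 1" for i by (auto simp: f_def div_Suc)
  have chord: "\<bar>f ((b + q) * L) - f (b * L + 1)\<bar> \<le> 1" for b
  proof -
    have "(b + q) * L = b * L + 1 + D" using D(3) by (simp add: algebra_simps)
    then show ?thesis using D(1) by (simp add: f_def del: add_Suc add_Suc_right)
  qed
  have "t \<le> s + D" using st D(2) g by simp
  then have "t div D \<le> (s + D) div D" by (rule div_le_mono)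
  moreover have "(s + D) div D = s div D + 1" using D(1) by simp
  moreover have "s div D \<le> t div D" using st g by (intro div_le_mono) simp
  ultimately have "\<bar>f t - f s\<bar> \<le> 1" by (simp add: f_def)
  then have lip: "\<bar>f v - f u\<bar> \<le> 1" if "(u, v) \<in> add_edge s t (grid n L q k)" for u v
    using that grid_lipschitz[of n f k q L, OF step chord] by (auto simp: add_edge_def abs_minus_commute)
  have "(g - 1) * D + 1 \<le> g * (D + 1)" using g by (cases g) (auto simp: algebra_simps)
  also have "\<dots> \<le> n" using large D(3) by (simp add: mult.assoc)
  finally have "(g - 1) * D \<le> n - 1" by simp
  then have "g - 1 \<le> (n - 1) div D" using D(1) by (simp add: less_eq_div_iff_mult_less_eq)
  then have "f 0 + int (g - 2) < f (n - 1)" using g by (simp add: f_def)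
  then show ?thesis by (intro not_near_lipschitz[of _ f] lip disjI1)
qed

lemma girth_ge_skeleton: "girth_ge g (skeleton n L q N s t)"
proof (cases "q \<le> N")
  case True
  then have "girth_ge g (grid n L q (N - q))" by (intro girth_ge_grid) simp
  then show ?thesis unfolding skeleton_def
    by (intro girth_ge_add_edge sym_add_edge sym_grid far_special far_wrap)
next
  case False
  then have "N - q = 0" by simp
  then have "girth_ge g (grid n L q (N - q))" using girth_ge_path[of g n] g by (simp add: grid_def chord_arcs_def)
  then show ?thesis unfolding skeleton_def
    by (intro girth_ge_add_edge sym_add_edge sym_grid far_special far_wrap)
qed

definition matching :: "nat rel" where
  "matching = chord_arcs L q (N - q) \<union> {(s, t)}"

definition ring :: "nat rel" where
  "ring = path_arcs n \<union> {(0, n - 1), (n - 1, 0)}"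

lemma skeleton_eq: "skeleton n L q N s t = ring \<union> (matching \<union> matching\<inverse>)"
  by (auto simp: skeleton_def add_edge_def grid_def ring_def matching_def)

lemma st_cases: "s = 0 \<and> t = 2 * L - 1 \<or> s = 2 \<and> t = 2 * L"
  using st Lg g by (cases "g = 2 * L") auto

lemma matching_ends:
  assumes "(u, v) \<in> matching"
  shows "(u = s \<and> v = t) \<or> (\<exists>b. b + q < N \<and> u = b * L + 1 \<and> v = (b + q) * L)"
  using assms by (auto simp: matching_def chord_arcs_def less_diff_conv)

text \<open>The choice of s depends on the parity of g. The possible values 0 and 2L are first
  vertices of blocks 0 and 2, which receive no chord as q \<ge> 4; the values 2 and 2L - 1 are
  neither first nor second in their blocks as L \<ge> 3.\<close>

lemma special_neq:
  "s \<noteq> b * L + 1" "s \<noteq> (b + q) * L" "t \<noteq> b * L + 1" "t \<noteq> (b + q) * L" "s \<noteq> t"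
proof -
  have aux: "s \<noteq> B + 1 \<and> s \<noteq> Q \<and> t \<noteq> B + 1 \<and> t \<noteq> Q \<and> s \<noteq> t"
    if "B = 0 \<or> B = L \<or> 2 * L \<le> B" "4 * L \<le> Q" "s = 0 \<and> t = 2 * L - 1 \<or> s = 2 \<and> t = 2 * L" "3 \<le> L"
    for B L Q s t :: nat
    using that by (intro conjI notI; elim disjE conjE; linarith)
  have big: "4 * L \<le> (b + q) * L" using q by (intro mult_le_mono1) simp
  consider "b = 0" | "b = 1" | "2 \<le> b" by linarith
  then have b: "b * L = 0 \<or> b * L = L \<or> 2 * L \<le> b * L" by cases (auto intro: mult_le_mono1)
  show "s \<noteq> b * L + 1" "s \<noteq> (b + q) * L" "t \<noteq> b * L + 1" "t \<noteq> (b + q) * L" "s \<noteq> t"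
    using b big st_cases L3 aux[of "b * L" L "(b + q) * L" s t] by blast+
qed

lemma chord_ends_neq: "b * L + 1 \<noteq> c * L"
proof
  assume "b * L + 1 = c * L"
  moreover have "(b * L + 1) mod L = 1 mod L" by (rule mod_mult_self3)
  ultimately show False using L3 by simp
qed

lemma matching_Image: "(u, v) \<in> matching \<union> matching\<inverse> \<Longrightarrow> (matching \<union> matching\<inverse>) `` {u} = {v}"
proof -
  have L0: "b * L = c * L \<longleftrightarrow> b = c" for b c :: nat using L3 by simp
  have *: "v = v'" if "(u, v) \<in> matching \<union> matching\<inverse>" "(u, v') \<in> matching \<union> matching\<inverse>" for v v'
  proof -
    note ne = special_neq special_neq[symmetric] chord_ends_neq chord_ends_neq[symmetric]
    have m1: "v = v'" if "(u, v) \<in> matching" "(u, v') \<in> matching" for u v v'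
      using matching_ends[OF that(1)] matching_ends[OF that(2)] ne L0 by (metis add_right_cancel)
    have m2: "v = v'" if "(v, u) \<in> matching" "(v', u) \<in> matching" for u v v'
      using matching_ends[OF that(1)] matching_ends[OF that(2)] ne L0 by (metis add_right_cancel)
    have m3: False if "(u, v) \<in> matching" "(v', u) \<in> matching" for u v v'
      using matching_ends[OF that(1)] matching_ends[OF that(2)] ne by metis
    show ?thesis using that m1 m2 m3 by blast
  qed
  assume "(u, v) \<in> matching \<union> matching\<inverse>"
  then show ?thesis using * by blast
qed

lemma n_large: "2 * L < n" "3 \<le> n"
proof -
  have "5 * (4 * L) \<le> g * (q * L)" using g q by (intro mult_le_mono) auto
  moreover have "g * (q * L) \<le> n" using large by (simp only: mult.assoc)
  ultimately show "2 * L < n" "3 \<le> n" using L3 by linarith+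
qed

lemma block_start_less: "b < N \<Longrightarrow> b * L < n"
proof -
  assume "b < N"
  then have "(b + 1) * L \<le> N * L" by (intro mult_le_mono1) simp
  then show ?thesis using N(2) by simp
qed

lemma matching_subset: "matching \<subseteq> {..<n} \<times> {..<n}"
proof (rule subrelI)
  fix u v assume "(u, v) \<in> matching"
  then consider "u = s" "v = t" | b where "b + q < N" "u = b * L + 1" "v = (b + q) * L"
    using matching_ends by blast
  then show "(u, v) \<in> {..<n} \<times> {..<n}"
  proof cases
    case 1
    then show ?thesis using st_cases n_large L3 by auto
  next
    case 2
    have "b * L + q * L < n" using block_start_less[OF 2(1)] by (simp add: algebra_simps)
    then have "b * L + 1 < n" using qL L3 by linarith
    then show ?thesis using 2 block_start_less[OF 2(1)] by simp
  qed
qed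

lemma ring_Image:
  assumes "v < n"
  shows "card (ring `` {v}) = 2"
proof -
  consider "v = 0" | "v = n - 1" "v \<noteq> 0" | "0 < v" "Suc v < n" using assms by linarith
  then show ?thesis
  proof cases
    case 1
    then have "ring `` {v} = {1, n - 1}" using n_large by (auto simp: ring_def path_arcs_def)
    then show ?thesis using n_large by simp
  next
    case 2
    then have "ring `` {v} = {n - 2, 0}" using n_large by (auto simp: ring_def path_arcs_def)
    then show ?thesis using n_large by simp
  next
    case 3
    then have "ring `` {v} = {v - 1, Suc v}" by (auto simp: ring_def path_arcs_def)
    then show ?thesis using 3 by simp
  qed
qed

lemma skeleton_sym: "sym (skeleton n L q N s t)"
  unfolding skeleton_def by (intro sym_add_edge sym_grid)

lemma skeleton_irrefl: "irrefl (skeleton n L q N s t)"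
proof -
  have "(v, v) \<notin> ring" for v using n_large by (auto simp: ring_def path_arcs_def)
  moreover have "(v, v) \<notin> matching" for v
    using matching_ends[of v v] special_neq(5) chord_ends_neq by metis
  ultimately show ?thesis by (auto simp: skeleton_eq irrefl_def)
qed

lemma skeleton_subset: "skeleton n L q N s t \<subseteq> {..<n} \<times> {..<n}"
  using matching_subset n_large by (auto simp: skeleton_eq ring_def path_arcs_def)

lemma skeleton_degree:
  assumes "v < n"
  shows "card (skeleton n L q N s t `` {v}) \<in> {2, 3}"
proof -
  let ?M = "matching \<union> matching\<inverse>"
  have fr: "finite (ring `` {v})" using ring_Image[OF assms] by (metis card.infinite zero_neq_numeral)
  have eq: "skeleton n L q N s t `` {v} = ring `` {v} \<union> ?M `` {v}" by (auto simp: skeleton_eq)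
  have M: "finite (?M `` {v}) \<and> card (?M `` {v}) \<le> 1"
  proof (cases "?M `` {v} = {}")
    case False
    then obtain w where "(v, w) \<in> ?M" by blast
    then show ?thesis using matching_Image by simp
  qed simp
  have "card (ring `` {v} \<union> ?M `` {v}) \<le> 3"
    using card_Un_le[of "ring `` {v}" "?M `` {v}"] M ring_Image[OF assms] by linarith
  moreover have "card (ring `` {v}) \<le> card (ring `` {v} \<union> ?M `` {v})"
    using fr M by (intro card_mono) auto
  ultimately show ?thesis unfolding eq using ring_Image[OF assms] by auto
qed

lemma card_skeleton_degree_two:
  "n \<le> card {v \<in> {..<n}. card (skeleton n L q N s t `` {v}) = 2} + 2 * (N - q) + 2"
proof -
  let ?R = "(\<lambda>b. b * L + 1) ` {..<N - q} \<union> (\<lambda>b. (b + q) * L) ` {..<N - q} \<union> {s, t}"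
  let ?F = "{v \<in> {..<n}. card (skeleton n L q N s t `` {v}) = 2}"
  have "{..<n} \<subseteq> ?F \<union> ?R"
  proof
    fix v assume v: "v \<in> {..<n}"
    show "v \<in> ?F \<union> ?R"
    proof (cases "v \<in> ?R")
      case False
      then have "(matching \<union> matching\<inverse>) `` {v} = {}" by (auto simp: matching_def chord_arcs_def)
      then have "skeleton n L q N s t `` {v} = ring `` {v}" by (auto simp: skeleton_eq)
      then show ?thesis using ring_Image v by simp
    qed blast
  qed
  then have "card {..<n} \<le> card (?F \<union> ?R)" by (intro card_mono) auto
  also have "\<dots> \<le> card ?F + card ?R" by (rule card_Un_le)
  also have "card ?R \<le> card ((\<lambda>b. b * L + 1) ` {..<N - q}) + card ((\<lambda>b. (b + q) * L) ` {..<N - q}) + card {s, t}"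
    using card_Un_le[of "(\<lambda>b. b * L + 1) ` {..<N - q} \<union> (\<lambda>b. (b + q) * L) ` {..<N - q}" "{s, t}"]
      card_Un_le[of "(\<lambda>b. b * L + 1) ` {..<N - q}" "(\<lambda>b. (b + q) * L) ` {..<N - q}"] by linarith
  also have "\<dots> \<le> (N - q) + (N - q) + 2"
    by (intro add_mono) (auto intro: order_trans[OF card_image_le] simp: card_insert_if)
  finally show ?thesis by simp
qed

lemma skeleton_arcs:
  shows "Suc i < n \<Longrightarrow> (i, Suc i) \<in> skeleton n L q N s t"
    and "(n - 1, 0) \<in> skeleton n L q N s t"
    and "b + q < N \<Longrightarrow> (b * L + 1, (b + q) * L) \<in> skeleton n L q N s t"
    and "(t, s) \<in> skeleton n L q N s t"
  by (auto simp: skeleton_eq ring_def path_arcs_def matching_def chord_arcs_def)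

end

section \<open>Connected cut-sets\<close>

definition graph_of :: "'a set \<Rightarrow> 'a rel \<Rightarrow> 'a pair_pre_digraph" where
  "graph_of V E = \<lparr>pverts = V, parcs = E\<rparr>"

lemma graph_of_simps [simp]: "pverts (graph_of V E) = V" "parcs (graph_of V E) = E"
  by (simp_all add: graph_of_def)

text \<open>\<open>connected\<close> means strong connectivity of the symmetric closure, and the
  arcs here are already symmetric.\<close>

lemma connected_induced_iff:
  assumes "sym E"
  shows "connected (with_proj (graph_of V E) \<restriction> W) \<longleftrightarrow>
    W \<noteq> {} \<and> (\<forall>u\<in>W. \<forall>v\<in>W. (u, v) \<in> rtrancl_on W (E \<inter> W \<times> W))"
proof -
  have "parcs (mk_symmetric (with_proj (graph_of V E) \<restriction> W)) = E \<inter> W \<times> W"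
    using assms by (auto simp: mk_symmetric_def induce_subgraph_def dest: symD)
  moreover have "pverts (mk_symmetric (with_proj (graph_of V E) \<restriction> W)) = W"
    by (simp add: mk_symmetric_def)
  ultimately show ?thesis
    by (simp add: connected_def strongly_connected_def reachable_def)
qed

lemma not_connected_split:
  assumes "sym E" "\<not> connected (with_proj (graph_of V E) \<restriction> W)" "W \<noteq> {}"
  shows "\<exists>A B. A \<union> B = W \<and> A \<inter> B = {} \<and> A \<noteq> {} \<and> B \<noteq> {} \<and> E \<inter> A \<times> B = {}"
proof -
  let ?R = "rtrancl_on W (E \<inter> W \<times> W)"
  obtain u v where uv: "u \<in> W" "v \<in> W" "(u, v) \<notin> ?R"
    using assms connected_induced_iff by blast
  let ?A = "{w. (u, w) \<in> ?R}"
  have sub: "?A \<subseteq> W" using in_rtrancl_on_in_F by fast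
  have "E \<inter> ?A \<times> (W - ?A) = {}"
  proof (rule ccontr)
    assume "\<not> ?thesis"
    then obtain a b where ab: "(a, b) \<in> E" "(u, a) \<in> ?R" "b \<in> W" "(u, b) \<notin> ?R" by blast
    then have "(a, b) \<in> E \<inter> W \<times> W" using sub by blast
    then show False using ab rtrancl_on_into_rtrancl_on by metis
  qed
  moreover have "u \<in> ?A" "v \<in> W - ?A" using uv by auto
  moreover have "?A \<union> (W - ?A) = W" using sub by blast
  ultimately show ?thesis by blast
qed

lemma connected_crossing_arc:
  assumes "sym E" "connected (with_proj (graph_of V E) \<restriction> W)" "S \<subseteq> W" "S \<noteq> {}" "S \<noteq> W"
  shows "\<exists>x y. (x, y) \<in> E \<and> x \<in> S \<and> y \<in> W - S"
proof (rule ccontr)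
  assume none: "\<not> ?thesis"
  obtain s v where sv: "s \<in> S" "v \<in> W - S" using assms(3-5) by blast
  have "(s, v) \<in> rtrancl_on W (E \<inter> W \<times> W)"
    using assms(2,3) sv connected_induced_iff[OF assms(1)] by blast
  then have "v \<in> S"
    by (induction rule: rtrancl_on_induct) (use sv none in blast)+
  then show False using sv by blast
qed

text \<open>A single vertex has boundary 3. Growing the set along crossing arcs adds vertices with
  at least one neighbour inside, and each raises the boundary by at most 3 - 2 = 1.\<close>

lemma card_boundary_connected:
  assumes cub: "cubic_graph V E" and C: "C \<subseteq> V" "connected (with_proj (graph_of V E) \<restriction> C)"
  shows "card (boundary E C) \<le> card C + 2"
proof -
  have E: "finite V" "sym E" "irrefl E" using cub by (auto simp: cubic_graph_def)
  have fC: "finite C" using C(1) E(1) by (rule finite_subset)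
  have "C \<noteq> {}" using C(2) connected_induced_iff[OF E(2)] by blast
  then obtain x where x: "x \<in> C" by blast
  let ?P = "\<lambda>S. S \<subseteq> C \<and> S \<noteq> {} \<and> card (boundary E S) \<le> card S + 2"
  have "boundary E {x} = {x} \<times> E `` {x}" using E(3) by (auto simp: boundary_def irrefl_def)
  then have "card (boundary E {x}) = 3" using cub x C(1) by (auto simp: card_cartesian_product cubic_graph_def)
  then have Px: "?P {x}" using x by simp
  have "\<forall>S. ?P S \<longrightarrow> card S < card C + 1" using fC card_mono by (metis Suc_eq_plus1 le_imp_less_Suc)
  then obtain S where S: "?P S" "\<And>S'. ?P S' \<Longrightarrow> card S' \<le> card S"
    using ex_has_greatest_nat[of ?P "{x}" card "card C + 1"] Px by blast
  have "S = C"
  proof (rule ccontr)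
    assume "S \<noteq> C"
    then obtain a y where y: "(a, y) \<in> E" "a \<in> S" "y \<in> C - S"
      using connected_crossing_arc[OF E(2) C(2)] S(1) by blast
    have fS: "finite S" using S(1) fC finite_subset by blast
    have "a \<in> E `` {y} \<inter> S" using y E(2) by (auto dest: symD)
    then have c0: "card (E `` {y} \<inter> S) \<noteq> 0" using fS by auto
    have "card (insert y S) = card S + 1" using y(3) fS by simp
    moreover have "card (boundary E (insert y S)) + 2 * card (E `` {y} \<inter> S) = card (boundary E S) + 3"
      using boundary_insert[OF cub, of S y] S(1) y(3) C(1) by blast
    ultimately have "card (boundary E (insert y S)) \<le> card (insert y S) + 2"
      using S(1) c0 by linarith
    then have "card (insert y S) \<le> card S" using S y(3) by (intro S(2)) auto
    then show False using y(3) fS by simp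
  qed
  then show ?thesis using S(1) by blast
qed

section \<open>Cycles as arc lists, and the girth of the graph\<close>

lemma pawalk_verts_ends: "pcas a p b \<Longrightarrow> a \<in> set (pawalk_verts a p) \<and> b \<in> set (pawalk_verts a p)"
  by (induction p arbitrary: a) auto

lemma pawalk_verts_fst: "pcas a p b \<Longrightarrow> e \<in> set p \<Longrightarrow> fst e \<in> set (pawalk_verts a p)"
  by (induction p arbitrary: a) auto

lemma pawalk_verts_snd: "pcas a p b \<Longrightarrow> e \<in> set p \<Longrightarrow> snd e \<in> set (pawalk_verts a p)"
  by (induction p arbitrary: a) (auto dest: pawalk_verts_ends)

lemma near_of_pcas: "pcas a p b \<Longrightarrow> set p \<subseteq> F \<Longrightarrow> near F (length p) a b"
proof (induction p arbitrary: a)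
  case (Cons e p)
  then have "near F (length p) (snd e) b" "(a, snd e) \<in> F" by auto
  then show ?case unfolding length_Cons near_Suc2 by blast
qed simp

text \<open>Behind its first arc (u, v) the cycle is a walk from v back to u. Distinctness of its
  vertices and length at least 3 ensure that this walk uses the edge uv in neither
  direction.\<close>

lemma undirected_cycle_length:
  assumes girth: "girth_ge g E" and symE: "sym E" and cyc: "undirected_cycle (graph_of V E) p"
  shows "g \<le> length p"
proof -
  obtain u where u: "set p \<subseteq> E" "pcas u p u" "distinct (tl (pawalk_verts u p))" "3 \<le> length p"
    using cyc unfolding undirected_cycle_def pre_digraph.cycle_def pre_digraph.awalk_def
    by (auto simp: cas_with_proj_eq awalk_verts_with_proj_eq)
  obtain v w r where p: "p = (u, v) # (v, w) # r"
    using u(2,4) by (cases p; cases "tl p") auto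
  have d: "v \<notin> set (pawalk_verts w r)" "distinct (pawalk_verts w r)" and r: "pcas w r u"
    using u(2,3) by (auto simp: p)
  have "r \<noteq> []" using u(4) by (auto simp: p)
  have "v \<noteq> u" using d(1) pawalk_verts_ends[OF r] by auto
  have "w \<noteq> u"
  proof
    assume "w = u"
    obtain x r' where r': "r = (w, x) # r'" using \<open>r \<noteq> []\<close> r by (cases r) auto
    then have "u \<in> set (pawalk_verts x r')" using r pawalk_verts_ends[of x r' u] by simp
    then show False using d(2) r' \<open>w = u\<close> by simp
  qed
  have "(u, v) \<notin> set ((v, w) # r)" "(v, u) \<notin> set ((v, w) # r)"
    using d(1) \<open>v \<noteq> u\<close> \<open>w \<noteq> u\<close> pawalk_verts_fst[OF r, of "(v, u)"] pawalk_verts_snd[OF r, of "(u, v)"] by auto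
  then have "set ((v, w) # r) \<subseteq> del_edge v u E"
    using u(1) by (auto simp: p del_edge_def)
  moreover have "pcas v ((v, w) # r) u" using r by simp
  ultimately have "near (del_edge v u E) (length ((v, w) # r)) v u" by (intro near_of_pcas)
  moreover have "(v, u) \<in> E" using u(1) symE by (auto simp: p dest: symD)
  ultimately show ?thesis using girth_geD[OF girth] p by fastforce
qed

lemma interval_walk:
  "s \<le> t \<Longrightarrow> pcas s (map (\<lambda>i. (i, Suc i)) [s..<t] @ [(t, x)]) x \<and>
    pawalk_verts s (map (\<lambda>i. (i, Suc i)) [s..<t] @ [(t, x)]) = [s..<Suc t] @ [x]"
proof (induction "t - s" arbitrary: s)
  case (Suc k)
  then have "s < t" by simp
  then have e: "[s..<t] = s # [Suc s..<t]" "[s..<Suc t] = s # [Suc s..<Suc t]" by (simp_all add: upt_conv_Cons)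
  show ?case using Suc.hyps(1)[of "Suc s"] Suc.hyps(2) \<open>s < t\<close> unfolding e by simp
qed simp

text \<open>The upper bound is witnessed by the interval from s to t, closed by the arc (t,
  s).\<close>

lemma girth_graph_of:
  assumes girth: "girth_ge g E" and symE: "sym E" and EV: "E \<subseteq> V \<times> V"
    and c: "\<And>i. s \<le> i \<Longrightarrow> i < t \<Longrightarrow> (i, Suc i) \<in> E" "(t, s) \<in> E" "t + 1 = s + g" "3 \<le> g"
  shows "girth (graph_of V E) = enat g"
proof (rule antisym)
  let ?p = "map (\<lambda>i. (i, Suc i)) [s..<t] @ [(t, s)]"
  have st: "s \<le> t" using c by simp
  have "undirected_cycle (graph_of V E) ?p"
    unfolding undirected_cycle_def pre_digraph.cycle_def pre_digraph.awalk_def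
  proof (intro conjI exI[of _ s])
    show "s \<in> verts (with_proj (graph_of V E))" using c(2) EV by auto
    show "set ?p \<subseteq> arcs (with_proj (graph_of V E))" using c by auto
    show "pre_digraph.cas (with_proj (graph_of V E)) s ?p s"
      using interval_walk[OF st] by (simp only: cas_with_proj_eq)
    have "tl ([s..<Suc t] @ [s]) = [Suc s..<Suc t] @ [s]" using st by (simp add: upt_conv_Cons del: upt_Suc)
    then show "distinct (tl (pre_digraph.awalk_verts (with_proj (graph_of V E)) s ?p))"
      using interval_walk[OF st, of s] by (simp add: awalk_verts_with_proj_eq del: upt_Suc)
  qed (use c in auto)
  then have "girth (graph_of V E) \<le> enat (length ?p)" unfolding girth_def by (intro INF_lower) simp
  moreover have "length ?p = g" using c(3,4) by simp
  ultimately show "girth (graph_of V E) \<le> enat g" by simp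
  show "enat g \<le> girth (graph_of V E)"
    unfolding girth_def by (intro INF_greatest) (use undirected_cycle_length[OF girth symE] in auto)
qed

section \<open>Numerical estimates\<close>

text \<open>Steps of 8 make \<open>(h + 1) div 8\<close> rise by exactly one, so the power gains a
  factor 2^7 = 128, while each linear factor grows at most fivefold and the product at most by 125.
  The constants 16 and 20 are 8 * 2 and 8 * 5/2 from the comparison with the Moore bound.\<close>

lemma polynomial_below_power: "9 \<le> h \<Longrightarrow> (h + 5) * (h + 3) * (h + 1) + 16 < 20 * 2 ^ (h - 1 - (h + 1) div 8)" for h :: nat
proof (induction h rule: less_induct)
  case (less h)
  show ?case
  proof (cases "h < 17")
    case True
    then have "h \<in> {9, 10, 11, 12, 13, 14, 15, 16}" using less.prems by auto
    then show ?thesis by auto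
  next
    case False
    define j where "j = h - 8"
    have j: "h = j + 8" "9 \<le> j" using False by (simp_all add: j_def)
    have IH: "(j + 5) * (j + 3) * (j + 1) + 16 < 20 * 2 ^ (j - 1 - (j + 1) div 8)" using less.IH[of j] j by simp
    have scale: "A \<le> 125 * B \<Longrightarrow> A + 16 \<le> 128 * (B + 16)" for A B :: nat by simp
    have "(h + 5) * (h + 3) * (h + 1) \<le> (5 * (j + 5)) * (5 * (j + 3)) * (5 * (j + 1))"
      using j by (intro mult_le_mono) auto
    also have "\<dots> = 125 * ((j + 5) * (j + 3) * (j + 1))" by (simp add: algebra_simps)
    finally have "(h + 5) * (h + 3) * (h + 1) + 16 \<le> 128 * ((j + 5) * (j + 3) * (j + 1) + 16)" by (rule scale)
    also have "\<dots> < 128 * (20 * 2 ^ (j - 1 - (j + 1) div 8))" using IH by (rule mult_strict_left_mono) simp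
    also have "\<dots> = 20 * 2 ^ (7 + (j - 1 - (j + 1) div 8))" by (simp add: power_add)
    also have "7 + (j - 1 - (j + 1) div 8) = h - 1 - (h + 1) div 8" using j by simp
    finally show ?thesis .
  qed
qed

lemma linear_below_power: "3 \<le> h \<Longrightarrow> 2 * h + 4 < 3 * 2 ^ (h - 1)" "5 \<le> h \<Longrightarrow> 6 * h + 10 < 5 * 2 ^ (h - 1)" for h :: nat
proof -
  show "2 * h + 4 < 3 * 2 ^ (h - 1)" if "3 \<le> h"
    using that
  proof (induction h rule: nat_induct_at_least)
    case (Suc h)
    then obtain j where "h = Suc j" by (cases h) auto
    then show ?case using Suc by simp
  qed simp
  show "6 * h + 10 < 5 * 2 ^ (h - 1)" if "5 \<le> h"
    using that
  proof (induction h rule: nat_induct_at_least)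
    case (Suc h)
    then obtain j where "h = Suc j" by (cases h) auto
    then show ?case using Suc by simp
  qed simp
qed

text \<open>
  For $a \le 3$ the bound by windows would be too weak for small $g$; there the number $aL$ of vertices
  in the blocks near the cut is used.
\<close>
lemma small_side_impossible:
  fixes a h L x :: nat
  assumes a: "2 \<le> a" "a \<le> (h + 1) div 2" and L: "L \<le> h + 1"
    and few: "x \<le> (a div 2 + 1) * (max 4 ((h + 1) div 2 + 1) * L)" "a \<le> 3 \<Longrightarrow> x \<le> a * L"
    and moore: "\<And>k. 2 ^ (h - 1) / 2 ^ k * (4 + (4 * real k - real a) / 2) \<le> real x + 2"
  shows False
proof -
  have m0: "2 ^ (h - 1) * (8 - real a) \<le> 2 * real x + 4" using moore[of 0] by (simp add: field_simps)
  consider "a = 2" | "a = 3" | "4 \<le> a" using a by linarith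
  then show False
  proof cases
    case 1
    have h: "3 \<le> h" using 1 a by linarith
    have "a * L \<le> a * (h + 1)" using L by (rule mult_le_mono2)
    then have "x \<le> 2 * (h + 1)" using few(2) 1 by simp
    moreover have "real (6 * 2 ^ (h - 1)) \<le> real (2 * x + 4)" using m0 1 by simp
    then have "6 * 2 ^ (h - 1) \<le> 2 * x + 4" by (simp only: of_nat_le_iff)
    moreover have False if "x \<le> 2 * (h + 1)" "6 * P \<le> 2 * x + 4" "2 * h + 4 < 3 * P" for P :: nat using that by presburger
    ultimately show False using linear_below_power(1)[OF h] by blast
  next
    case 2
    have h: "5 \<le> h" using 2 a by linarith
    have "a * L \<le> a * (h + 1)" using L by (rule mult_le_mono2)
    then have "x \<le> 3 * (h + 1)" using few(2) 2 by simp
    moreover have "real (5 * 2 ^ (h - 1)) \<le> real (2 * x + 4)" using m0 2 by simp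
    then have "5 * 2 ^ (h - 1) \<le> 2 * x + 4" by (simp only: of_nat_le_iff)
    moreover have False if "x \<le> 3 * (h + 1)" "5 * P \<le> 2 * x + 4" "6 * h + 10 < 5 * P" for P :: nat using that by presburger
    ultimately show False using linear_below_power(2)[OF h] by blast
  next
    case 3
    then have h7: "7 \<le> h" using a by linarith
    show False
    proof (cases "h \<le> 8")
      case True
      then have "a = 4" using a 3 by linarith
      \<comment> \<open>For h = 7 this says 128 \<le> x + 2 against x \<le> 3 * 5 * 8 = 120; for h =
        8 it says 256 \<le> x + 2 against x \<le> 135.\<close>
      then have "2 ^ (h - 1) * 2 \<le> real x + 2" using moore[of 1] by simp
      moreover have "h = 7 \<or> h = 8" using h7 True by linarith
      ultimately show False using few(1) L \<open>a = 4\<close> by auto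
    next
      case False
      \<comment> \<open>Close to the average share a/4 of the four branches; a \<le> 4k + 3 keeps
        the factor 4 + (4k - a)/2 at 5/2 or more.\<close>
      define k where "k = a div 4"
      have k: "k \<le> (h + 1) div 8" "real a \<le> 4 * real k + 3" using a(2) by (auto simp: k_def)
      have "4 * (a div 2 + 1) \<le> h + 5" "2 * max 4 ((h + 1) div 2 + 1) \<le> h + 3" using a(2) False by auto
      then have "(4 * (a div 2 + 1)) * (2 * max 4 ((h + 1) div 2 + 1)) * L \<le> (h + 5) * (h + 3) * (h + 1)"
        using L by (intro mult_le_mono)
      note prod = this
      have eq: "8 * (u * (v * L)) = (4 * u) * (2 * v) * L" for u v by simp
      have "8 * x \<le> 8 * ((a div 2 + 1) * (max 4 ((h + 1) div 2 + 1) * L))" using few(1) by (rule mult_le_mono2)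
      also have "\<dots> = (4 * (a div 2 + 1)) * (2 * max 4 ((h + 1) div 2 + 1)) * L" by (rule eq)
      also note prod
      finally have x8: "8 * x \<le> (h + 5) * (h + 3) * (h + 1)" .
      have "9 \<le> h" using False by simp
      then have "8 * x + 16 < 20 * 2 ^ (h - 1 - (h + 1) div 8)"
        using polynomial_below_power le_less_trans[OF add_le_mono1[OF x8]] by blast
      also have "\<dots> \<le> 20 * 2 ^ (h - 1 - k)" using k(1) by (intro mult_le_mono2 power_increasing) auto
      finally have "real (8 * x + 16) < real (20 * 2 ^ (h - 1 - k))" by (simp only: of_nat_less_iff)
      then have lt: "8 * real x + 16 < 20 * 2 ^ (h - 1 - k)" by simp
      have "2 ^ (h - 1) / 2 ^ k = (2::real) ^ (h - 1 - k)" using k(1) False by (intro power_diff[symmetric]) auto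
      then have "2 ^ (h - 1 - k) * (4 + (4 * real k - real a) / 2) \<le> real x + 2" using moore[of k] by simp
      moreover have "2 ^ (h - 1 - k) * (5 / 2) \<le> 2 ^ (h - 1 - k) * (4 + (4 * real k - real a) / 2)"
        using k(2) by (intro mult_left_mono) (simp_all add: field_simps)
      ultimately have "2 ^ (h - 1 - k) * (5 / 2) \<le> real x + 2" by linarith
      then show False using lt by linarith
    qed
  qed
qed

lemma parameters:
  fixes g n :: nat
  assumes g: "5 \<le> g" and n: "140 \<le> n" "2 ^ g * g \<le> n * (g - 4) + 4 * g"
  defines "L \<equiv> (g + 1) div 2" and "q \<equiv> max 4 ((g div 2 + 1) div 2 + 1)"
  defines "N \<equiv> (n + L - 1) div L"
  shows "g \<le> 2 * L" "2 * L \<le> g + 1" "4 \<le> q" "n \<le> N * L" "N * L < n + L" "g * q * L \<le> n"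
    and "n \<le> f + 2 * (N - q) + 2 \<Longrightarrow> 2 ^ g \<le> f + 4"
proof -
  show L: "g \<le> 2 * L" "2 * L \<le> g + 1" by (auto simp: L_def)
  show q4: "4 \<le> q" by (simp add: q_def)
  have L0: "0 < L" using L g by simp
  have "(n + L - 1) div L * L + (n + L - 1) mod L = n + L - 1" by (rule div_mult_mod_eq)
  moreover have "(n + L - 1) mod L < L" using L0 by simp
  ultimately show N: "n \<le> N * L" "N * L < n + L" using L0 unfolding N_def by linarith+
  define d where "d = g - 4"
  have d: "g = d + 4" using g by (simp add: d_def)
  have n4: "2 ^ g \<le> n + 4"
  proof -
    have "2 ^ g * g \<le> (n + 4) * g" using n(2) by (simp add: d algebra_simps)
    then show ?thesis using g by simp
  qed
  show large: "g * q * L \<le> n"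
  proof (cases "g < 8")
    case True
    \<comment> \<open>The three products are 60, 72 and 112. From g = 8 on the exponential bound on
      n suffices.\<close>
    then have "g = 5 \<or> g = 6 \<or> g = 7" using g by linarith
    then have "g * q * L \<le> 140" by (auto simp: q_def L_def)
    then show ?thesis using n(1) by linarith
  next
    case False
    have *: "8 \<le> g \<Longrightarrow> g * (g + 16) * (g + 1) + 32 \<le> 8 * 2 ^ g" for g :: nat
    proof (induction g rule: nat_induct_at_least)
      case (Suc g)
      have "Suc g * (Suc g + 16) * (Suc g + 1) + 32 = (g + 1) * (g * g + 19 * g + 34) + 32" by (simp add: algebra_simps)
      also have "\<dots> \<le> (g + 1) * (2 * (g * (g + 16))) + 32"
      proof -
        have "34 \<le> g * g" using mult_le_mono[OF Suc.hyps Suc.hyps] by simp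
        then show ?thesis by (intro add_le_mono1 mult_le_mono2) (simp add: algebra_simps)
      qed
      also have "\<dots> \<le> 2 * (g * (g + 16) * (g + 1) + 32)" by (simp add: algebra_simps)
      also have "\<dots> \<le> 8 * 2 ^ Suc g" using Suc.IH by simp
      finally show ?case .
    qed simp
    have "g * (4 * q) * (2 * L) \<le> g * (g + 16) * (g + 1)"
      using L(2) by (intro mult_le_mono) (auto simp: q_def)
    then have "8 * (g * q * L) \<le> g * (g + 16) * (g + 1)" by (simp add: ac_simps)
    then show ?thesis using *[of g] n4 False by linarith
  qed
  show "2 ^ g \<le> f + 4" if f: "n \<le> f + 2 * (N - q) + 2"
  proof -
    define K where "K = N - q"
    have "1 * q \<le> g * q" using g by (intro mult_le_mono1) simp
    then have "q * L \<le> g * q * L" by (intro mult_le_mono1) simp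
    then have "q * L \<le> N * L" using large N(1) by linarith
    then have "q \<le> N" using L0 by simp
    then have NK: "N = K + q" by (simp add: K_def)
    have KL: "K * L + q * L < n + L" using N(2) unfolding NK by (simp add: algebra_simps)
    moreover have "4 * L \<le> q * L" using q4 by (rule mult_le_mono1)
    \<comment> \<open>The q blocks that emit no chord make up for the incomplete last block and for
      the two ends of the extra chord.\<close>
    ultimately have "K * L + L \<le> n" by linarith
    have "g * (2 * K + 2) \<le> 2 * L * (2 * K + 2)" using L(1) by (rule mult_le_mono1)
    also have "\<dots> = 4 * (K * L + L)" by (simp add: algebra_simps)
    also have "\<dots> \<le> 4 * n" using \<open>K * L + L \<le> n\<close> by simp
    finally have gK: "g * (2 * K + 2) \<le> 4 * n" .
    have "g * n \<le> g * (f + (2 * K + 2))" using f unfolding K_def by (intro mult_le_mono2) simp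
    then have "g * n \<le> g * f + 4 * n" using gK by (simp add: distrib_left)
    then have "n * (g - 4) \<le> g * f" by (simp add: d algebra_simps)
    then have "2 ^ g * g \<le> (f + 4) * g" using n(2) by (simp add: algebra_simps)
    then show ?thesis using g by simp
  qed
qed


section \<open>The lower bound for connected cut-sets and the final graph\<close>

text \<open>The Moore bound needs a set at least as large as its boundary. A small side
  \<open>X\<close> that violates this is either \<open>A\<close>, and then the bound is applied to
  \<open>A\<close> together with \<open>C\<close>, or the complement of \<open>A\<close>, which
  cannot be so small since it contains \<open>C\<close> and \<open>B\<close>.\<close>

lemma no_small_connected_cut_set:
  fixes V :: "'a set"
  assumes cub: "cubic_graph V E" and girth: "girth_ge g E" and h: "h = g div 2" "2 \<le> h" "h \<le> card V"
    and L: "L \<le> h + 1" and q: "q = max 4 ((h + 1) div 2 + 1)"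
    and iso: "\<And>A. A \<subseteq> V \<Longrightarrow> A \<noteq> {} \<Longrightarrow> A \<noteq> V \<Longrightarrow> card (boundary E A) < q \<Longrightarrow>
      2 \<le> card (boundary E A) \<and> (\<exists>X. (X = A \<or> X = V - A) \<and>
        card X \<le> (card (boundary E A) div 2 + 1) * (q * L) \<and>
        (card (boundary E A) \<le> 3 \<longrightarrow> card X \<le> card (boundary E A) * L))"
    and C: "connected_cut_set (graph_of V E) C"
  shows "h \<le> card C"
proof (rule ccontr)
  assume "\<not> h \<le> card C"
  then have Ch: "card C < h" by simp
  have E: "finite V" "E \<subseteq> V \<times> V" "sym E" using cub by (auto simp: cubic_graph_def)
  have fE: "finite E" using cub by (rule finite_arcs)
  have C': "C \<subseteq> V" "\<not> connected (with_proj (graph_of V E) \<restriction> (V - C))" "connected (with_proj (graph_of V E) \<restriction> C)"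
    using C by (auto simp: connected_cut_set_def cut_set_def)
  have fC: "finite C" using C'(1) E(1) by (rule finite_subset)
  \<comment> \<open>The empty graph counts as disconnected, so the cut-set \<open>V\<close> itself
    has to be excluded by size.\<close>
  have "V - C \<noteq> {}" using Ch h(3) card_mono[OF fC, of V] by auto
  then obtain A0 B0 where AB0: "A0 \<union> B0 = V - C" "A0 \<inter> B0 = {}" "A0 \<noteq> {}" "B0 \<noteq> {}" "E \<inter> A0 \<times> B0 = {}"
    using not_connected_split[OF E(3) C'(2)] by blast
  have fb: "finite (boundary E S)" for S using fE by (rule finite_subset[rotated]) (auto simp: boundary_def)
  have "boundary E A0 \<union> boundary E B0 \<subseteq> (boundary E C)\<inverse>"
  proof (rule subrelI)
    fix u v assume uv: "(u, v) \<in> boundary E A0 \<union> boundary E B0"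
    then have "(u, v) \<in> E" "(v, u) \<in> E" "v \<in> V" using E(2,3) by (auto simp: boundary_def dest: symD)
    moreover have "u \<notin> C" using uv AB0(1) by (auto simp: boundary_def)
    moreover have "v \<in> C"
    proof (rule ccontr)
      assume "v \<notin> C"
      then have "v \<in> A0 \<or> v \<in> B0" using \<open>v \<in> V\<close> AB0(1) by blast
      then have "(u, v) \<in> A0 \<times> B0 \<or> (v, u) \<in> A0 \<times> B0" using uv by (auto simp: boundary_def)
      then show False using \<open>(u, v) \<in> E\<close> \<open>(v, u) \<in> E\<close> AB0(5) by blast
    qed
    ultimately show "(u, v) \<in> (boundary E C)\<inverse>" by (simp add: boundary_def)
  qed
  then have "card (boundary E A0 \<union> boundary E B0) \<le> card ((boundary E C)\<inverse>)"
    by (rule card_mono[rotated]) (simp add: fb)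
  moreover have "boundary E A0 \<inter> boundary E B0 = {}" using AB0(2) by (auto simp: boundary_def)
  then have "card (boundary E A0 \<union> boundary E B0) = card (boundary E A0) + card (boundary E B0)"
    by (rule card_Un_disjoint[OF fb fb])
  moreover have "card (boundary E C) \<le> card C + 2" by (rule card_boundary_connected[OF cub C'(1,3)])
  ultimately have sum0: "card (boundary E A0) + card (boundary E B0) \<le> card C + 2" by simp
  obtain A B where AB: "A \<union> B = V - C" "A \<inter> B = {}" "A \<noteq> {}" "B \<noteq> {}"
    and sum: "card (boundary E A) + card (boundary E B) \<le> card C + 2" and le: "card (boundary E A) \<le> card (boundary E B)"
  proof (cases "card (boundary E A0) \<le> card (boundary E B0)")
    case True
    then show ?thesis using that[of A0 B0] AB0 sum0 by simp
  next
    case False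
    then show ?thesis using that[of B0 A0] AB0 sum0 by (simp add: Un_commute Int_commute)
  qed
  define a where "a = card (boundary E A)"
  have a2: "2 * a \<le> card C + 2" using sum le by (simp add: a_def)
  then have ah: "a \<le> (h + 1) div 2" using Ch by linarith
  have A: "A \<subseteq> V" "A \<noteq> {}" "A \<noteq> V" using AB by auto
  have "a < q" using ah q by simp
  with iso[OF A] obtain X where X: "2 \<le> a" "X = A \<or> X = V - A"
    "card X \<le> (a div 2 + 1) * (q * L)" "a \<le> 3 \<Longrightarrow> card X \<le> a * L"
    unfolding a_def by blast
  have fin: "finite A" "finite B" using A(1) AB(1) E(1) by (auto intro: finite_subset)
  have compl: "card (boundary E (V - S)) = card (boundary E S)" if "S \<subseteq> V" for S
    using card_boundary_compl[OF E(3,2), of S] that by (simp add: Int_absorb2)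
  have bX: "card (boundary E X) = a" using X(2) compl[OF A(1)] by (auto simp: a_def)
  have hg: "2 * h \<le> g" using h(1) by simp
  show False
  proof (cases "a \<le> card X")
    case True
    have XV: "X \<subseteq> V" "X \<noteq> {}" using X(2) A AB by auto
    have "2 ^ (h - 1) / 2 ^ k * (4 + (4 * real k - real a) / 2) \<le> real (card X) + 2" for k
      using moore_bound(2)[OF cub girth XV _ hg h(2), of k] True ah bX by simp
    then show False using small_side_impossible[OF X(1) ah L] X(3,4) unfolding q by blast
  next
    case False
    show False
    proof (cases "X = A")
      case True
      \<comment> \<open>The boundary of this set is that of \<open>B\<close>, which is at most |C|
        because a \<ge> 2. Its size, however, is below a + h and hence below the 2h that the Moore
        bound demands.\<close>
      let ?Z = "A \<union> C"
      have Z: "?Z = V - B" using AB C'(1) by blast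
      have bZ: "card (boundary E ?Z) = card (boundary E B)" unfolding Z by (rule compl) (use AB in blast)
      have "card ?Z = card A + card C" using AB fin fC by (intro card_Un_disjoint) auto
      moreover have "card (boundary E B) \<le> card C" using sum X(1) by (simp add: a_def)
      ultimately have "2 * h \<le> card A + card C"
        using moore_bound(1)[OF cub girth, of ?Z h] A(1,2) C'(1) bZ hg h(2) Ch by simp
      moreover have "card A < a" using False True by simp
      ultimately show False using ah Ch by linarith
    next
      case notA: False
      then have XA: "X = V - A" using X(2) by simp
      \<comment> \<open>From 2a \<le> |C| + 2 and nonempty \<open>B\<close> this union has at least
        2a - 1 vertices, too many for |X| < a.\<close>
      have "C \<union> B \<subseteq> X" using AB(1,2) C'(1) unfolding XA by blast
      then have "card (C \<union> B) \<le> card X" by (rule card_mono[rotated]) (simp add: XA E(1))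
      moreover have "C \<inter> B = {}" using AB(1) by blast
      then have "card (C \<union> B) = card C + card B" by (rule card_Un_disjoint[OF fC fin(2)])
      moreover have "card B \<noteq> 0" using AB(4) fin by simp
      ultimately show False using False a2 by linarith
    qed
  qed
qed

lemma regular_graph_of: "regular k (graph_of V E) \<longleftrightarrow> (\<forall>v\<in>V. card (E `` {v}) = k)"
proof -
  have "out_arcs (with_proj (graph_of V E)) v = Pair v ` (E `` {v})" for v by (auto simp: out_arcs_def)
  then have "out_degree (with_proj (graph_of V E)) v = card (E `` {v})" for v
    by (simp add: out_degree_def card_image inj_on_def)
  then show ?thesis by (simp add: regular_def)
qed

lemma pair_graph_graph_of:
  assumes "cubic_graph V E"
  shows "pair_graph (graph_of V E)"
proof -
  have "finite E" using assms by (rule finite_arcs)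
  then show ?thesis
    using assms by unfold_locales (auto simp: cubic_graph_def irrefl_def symmetric_def)
qed

theorem mainTheorem4:
  fixes m g :: nat
  assumes "m \<ge> 70"
    and "g \<ge> 5"
    and "2 * int m \<ge> \<lceil>(2 ^ g - 4) / (real g - 4)\<rceil> * int g"
    and "\<And>h :: nat. h \<ge> 5 \<Longrightarrow> 2 * int m \<ge> \<lceil>(2 ^ h - 4) / (real h - 4)\<rceil> * int h \<Longrightarrow> h \<le> g"
  shows "\<exists>\<Gamma> :: nat pair_pre_digraph.
           pair_graph \<Gamma> \<and> regular 3 \<Gamma> \<and> girth \<Gamma> = enat g \<and> card (pverts \<Gamma>) = 2 * m \<and>
           (\<forall>C. connected_cut_set \<Gamma> C \<longrightarrow> g div 2 \<le> card C)"
proof -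
  define n where "n = 2 * m"
  have n140: "140 \<le> n" using assms(1) by (simp add: n_def)
  \<comment> \<open>The ceiling is dropped and the denominator cleared; the term 4g moves to the
    right to avoid truncated subtraction.\<close>
  have ng: "2 ^ g * g \<le> n * (g - 4) + 4 * g"
  proof -
    let ?x = "(2 ^ g - 4) / (real g - 4)"
    have "?x * real g \<le> of_int \<lceil>?x\<rceil> * real g" by (intro mult_right_mono) auto
    also have "\<dots> = of_int (\<lceil>?x\<rceil> * int g)" by simp
    also have "\<dots> \<le> of_int (2 * int m)" using assms(3) by (simp only: of_int_le_iff)
    finally have "?x * real g \<le> real n" by (simp add: n_def)
    then have "(2 ^ g - 4) * real g \<le> real n * (real g - 4)" using assms(2) by (simp add: field_simps)
    moreover have "real (n * (g - 4) + 4 * g) = real n * (real g - 4) + 4 * real g"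
      using assms(2) by (simp add: of_nat_diff)
    moreover have "real (2 ^ g * g) = (2 ^ g - 4) * real g + 4 * real g" by (simp add: left_diff_distrib)
    ultimately have "real (2 ^ g * g) \<le> real (n * (g - 4) + 4 * g)" by linarith
    then show ?thesis by (simp only: of_nat_le_iff)
  qed
  define h where "h = g div 2"
  define L where "L = (g + 1) div 2"
  define q where "q = max 4 ((g div 2 + 1) div 2 + 1)"
  define N where "N = (n + L - 1) div L"
  define s where "s = 2 * (2 * L - g)"
  define t where "t = s + g - 1"
  note P = parameters[OF assms(2) n140 ng, folded L_def q_def, folded N_def]
  note sk = assms(2) P(1-6) s_def t_def
  let ?S = "skeleton n L q N s t"
  let ?V = "{..<n}"
  have free: "2 ^ g \<le> card {v \<in> ?V. card (?S `` {v}) = 2} + 4"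
    using card_skeleton_degree_two[OF sk] by (rule P(7))
  have deg: "card (?S `` {v}) \<in> {2, 3}" if "v \<in> ?V" for v
    using skeleton_degree[OF sk] that by simp
  have even: "even (card ?V)" by (simp add: n_def)
  obtain E where E: "?S \<subseteq> E" "E \<subseteq> ?V \<times> ?V" "sym E" "irrefl E"
    "\<And>v. v \<in> ?V \<Longrightarrow> card (E `` {v}) = 3" "girth_ge g E"
    by (rule cubic_extension[OF finite_lessThan even assms(2) skeleton_sym[OF sk] skeleton_irrefl[OF sk]
        skeleton_subset[OF sk] deg girth_ge_skeleton[OF sk] free], assumption) (rule that; assumption)
  have cub: "cubic_graph ?V E" using E by (simp add: cubic_graph_def)
  note arcs = skeleton_arcs[OF sk, THEN subsetD[OF E(1)]]
  have L2: "2 \<le> L" using assms(2) by (simp add: L_def)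
  have large: "3 * q * L \<le> n"
  proof -
    have "3 * q * L \<le> g * q * L" using assms(2) by (intro mult_le_mono1) simp
    then show ?thesis using P(6) by linarith
  qed
  have q0: "0 < q" using P(3) by simp
  have iso: "2 \<le> card (boundary E A) \<and> (\<exists>X. (X = A \<or> X = ?V - A) \<and>
        card X \<le> (card (boundary E A) div 2 + 1) * (q * L) \<and>
        (card (boundary E A) \<le> 3 \<longrightarrow> card X \<le> card (boundary E A) * L))"
    if "A \<subseteq> ?V" "A \<noteq> {}" "A \<noteq> ?V" "card (boundary E A) < q" for A
    by (rule conjI; rule isoperimetry[OF cub arcs(1,2,3) L2 q0 P(4,5) large that]; assumption)
  have hV: "h \<le> card ?V"
  proof -
    have "1 * L \<le> 3 * q * L" using q0 by (intro mult_le_mono1) simp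
    then have "L \<le> n" using large by linarith
    moreover have "h \<le> L" by (simp add: h_def L_def)
    ultimately show ?thesis by simp
  qed
  have cut: "g div 2 \<le> card C" if "connected_cut_set (graph_of ?V E) C" for C
  proof -
    have "h \<le> card C"
    proof (rule no_small_connected_cut_set[OF cub E(6) h_def _ hV, of L q C])
      show "2 \<le> h" using assms(2) by (simp add: h_def)
      show "L \<le> h + 1" by (simp add: h_def L_def)
      show "q = max 4 ((h + 1) div 2 + 1)" by (simp add: h_def q_def)
      show "connected_cut_set (graph_of ?V E) C" by (rule that)
    qed (rule iso)
    then show ?thesis by (simp add: h_def)
  qed
  have "girth (graph_of ?V E) = enat g"
  proof (rule girth_graph_of[OF E(6,3,2)])
    show "(t, s) \<in> E" by (rule arcs(4))
    show "t + 1 = s + g" using assms(2) by (simp add: t_def)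
    show "(i, Suc i) \<in> E" if "s \<le> i" "i < t" for i
      using arcs(4) E(2) that by (intro arcs(1)) auto
  qed (use assms(2) in simp)
  then show ?thesis
    using pair_graph_graph_of[OF cub] E(5) cut
    by (intro exI[of _ "graph_of ?V E"]) (simp add: regular_graph_of n_def)
qed

end
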